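(* Let $\mathcal{X}\subseteq\{0,1\}^n$ be a non-empty downward closed set family, and let $\mu$ be a distribution fully supported on $\mathcal{X}$. If $M_S \preceq I$ for each non-maximal $S\in\mathcal{X}$, then the mixing time of the Glauber dynamics for $\mu$ satisfies $$T_{\mathrm{mix}}(P_{\mathrm{GD}}) = O\left((1+r_{\max})\, n\log\log\frac{1}{\mu_{\min}}\right),$$ where $\mu_{\min} = \min_{S\in\mathcal{X}}\mu(S)$.
   Context: Elements of $\{0,1\}^n$ are identified with subsets of $[n]$. $\mathcal{X}$ is downward closed if $T\in\mathcal{X}$ and $S\subseteq T$ imply $S\in\mathcal{X}$; $\mu$ is fully supported on $\mathcal{X}$ if $\mu(S)>0$ for all $S\in\mathcal{X}$ and $\mu(S)=0$ otherwise. For $S\in\mathcal{X}$ let $V_S=\{i\in[n]\setminus S : S\cup\{i\}\in\mathcal{X}\}$; $S$ is maximal if $V_S=\emptyset$. Let $\mu^S$ be the distribution on $\mathcal{X}^S=\{T\subseteq[n]\setminus S : S\cup T\in\mathcal{X}\}$ with $\mu^S(T)\propto\mu(S\cup T)$. For non-maximal $S$, the marginal ratio vector $\mathbf{r}_S\in\mathbb{R}^{V_S}$ is $\mathbf{r}_S(i)=\mu(S\cup\{i\})/\mu(S)$, and $r_{\max}=\max_{S\in\mathcal{X}}\max_{i\in V_S}\mathbf{r}_S(i)$. The pairwise dependency matrix $M_S\in\mathbb{R}^{V_S\times V_S}$ has $M_S(i,i)=0$ and, for $i\ne j$, $M_S(i,j)=\frac{\mu^S(\{i,j\})\mu^S(\emptyset)}{\mu^S(\{i\})\mu^S(\{j\})}-1$.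 $\preceq$ is the Loewner order and $I$ the identity. The Glauber dynamics for $\mu$ picks $i\in[n]$ uniformly at random, lets $S'=S_t\setminus\{i\}$; if $S'\cup\{i\}\notin\mathcal{X}$ sets $S_{t+1}=S'$, otherwise sets $S_{t+1}=S'\cup\{i\}$ with probability $\frac{\mu(S'\cup\{i\})}{\mu(S')+\mu(S'\cup\{i\})}$ and $S_{t+1}=S'$ otherwise. Mixing time: $T_{\mathrm{mix}}(P)=\max_{S}\min\{t: d_{\mathrm{TV}}(P^t(S,\cdot),\mu)\le 1/4\}$. *)

theory Defs
  imports "HOL-Probability.Probability"
begin

definition downward_closed :: "'a set set \<Rightarrow> bool" where
  "downward_closed X \<longleftrightarrow> (\<forall>T\<in>X. \<forall>S. S \<subseteq> T \<longrightarrow> S \<in> X)"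

definition fully_supported :: "'a pmf \<Rightarrow> 'a set \<Rightarrow> bool" where
  "fully_supported \<mu> X \<longleftrightarrow> (\<forall>S. if S \<in> X then pmf \<mu> S > 0 else pmf \<mu> S = 0)"

text \<open>
  The ground set \<open>[n]\<close> is \<open>{1..n}\<close>, and elements of \<open>{0,1}\<^sup>n\<close> are its subsets.
\<close>

definition extensions :: "nat \<Rightarrow> nat set set \<Rightarrow> nat set \<Rightarrow> nat set" where
  "extensions n X S = {i \<in> {1..n} - S. insert i S \<in> X}"

definition is_maximal :: "nat \<Rightarrow> nat set set \<Rightarrow> nat set \<Rightarrow> bool" where
  "is_maximal n X S \<longleftrightarrow> extensions n X S = {}"

definition link :: "nat \<Rightarrow> nat set set \<Rightarrow> nat set \<Rightarrow> nat set set" where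
  "link n X S = {T. T \<subseteq> {1..n} - S \<and> S \<union> T \<in> X}"

definition link_prob :: "nat \<Rightarrow> nat set set \<Rightarrow> nat set pmf \<Rightarrow> nat set \<Rightarrow> nat set \<Rightarrow> real" where
  "link_prob n X \<mu> S T =
     (if T \<in> link n X S then pmf \<mu> (S \<union> T) / (\<Sum>U\<in>link n X S. pmf \<mu> (S \<union> U)) else 0)"

definition marginal_ratio :: "nat set pmf \<Rightarrow> nat set \<Rightarrow> nat \<Rightarrow> real" where
  "marginal_ratio \<mu> S i = pmf \<mu> (insert i S) / pmf \<mu> S"

text \<open>
  All ratios are positive, so inserting \<open>0\<close> changes nothing unless there is no pair
  \<open>(S, i)\<close> at all, that is \<open>X = {{}}\<close>; the maximum is then \<open>0\<close> by convention.
\<close>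

definition r_max :: "nat \<Rightarrow> nat set set \<Rightarrow> nat set pmf \<Rightarrow> real" where
  "r_max n X \<mu> = Max (insert 0 (\<Union>S\<in>X. marginal_ratio \<mu> S ` extensions n X S))"

definition \<mu>_min :: "nat set set \<Rightarrow> nat set pmf \<Rightarrow> real" where
  "\<mu>_min X \<mu> = Min (pmf \<mu> ` X)"

text \<open>
  A real matrix indexed by \<open>V \<times> V\<close>, for a finite set \<open>V\<close>, is a function
  \<open>A i j\<close> of which only the values at \<open>i, j \<in> V\<close> are relevant.
\<close>

definition dependency_matrix ::
  "nat \<Rightarrow> nat set set \<Rightarrow> nat set pmf \<Rightarrow> nat set \<Rightarrow> nat \<Rightarrow> nat \<Rightarrow> real" where
  "dependency_matrix n X \<mu> S i j =
     (if i = j then 0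
      else link_prob n X \<mu> S {i, j} * link_prob n X \<mu> S {}
           / (link_prob n X \<mu> S {i} * link_prob n X \<mu> S {j}) - 1)"

definition identity_matrix :: "'a \<Rightarrow> 'a \<Rightarrow> real" where
  "identity_matrix i j = (if i = j then 1 else 0)"

definition symmetric_on :: "'a set \<Rightarrow> ('a \<Rightarrow> 'a \<Rightarrow> real) \<Rightarrow> bool" where
  "symmetric_on V A \<longleftrightarrow> (\<forall>i\<in>V. \<forall>j\<in>V. A i j = A j i)"

definition psd_on :: "'a set \<Rightarrow> ('a \<Rightarrow> 'a \<Rightarrow> real) \<Rightarrow> bool" where
  "psd_on V A \<longleftrightarrow> symmetric_on V A \<and> (\<forall>x. (\<Sum>i\<in>V. \<Sum>j\<in>V. x i * A i j * x j) \<ge> 0)"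

definition loewner_le :: "'a set \<Rightarrow> ('a \<Rightarrow> 'a \<Rightarrow> real) \<Rightarrow> ('a \<Rightarrow> 'a \<Rightarrow> real) \<Rightarrow> bool" where
  "loewner_le V A B \<longleftrightarrow>
     symmetric_on V A \<and> symmetric_on V B \<and> psd_on V (\<lambda>i j. B i j - A i j)"

definition glauber :: "nat \<Rightarrow> nat set set \<Rightarrow> nat set pmf \<Rightarrow> nat set \<Rightarrow> nat set pmf" where
  "glauber n X \<mu> S =
     pmf_of_set {1..n} \<bind> (\<lambda>i.
       let S' = S - {i} in
       if insert i S' \<notin> X then return_pmf S'
       else map_pmf (\<lambda>b. if b then insert i S' else S')
              (bernoulli_pmf (pmf \<mu> (insert i S') / (pmf \<mu> S' + pmf \<mu> (insert i S')))))"

definition chain_dist :: "('a \<Rightarrow> 'a pmf) \<Rightarrow> nat \<Rightarrow> 'a \<Rightarrow> 'a pmf" where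
  "chain_dist P t S = ((\<lambda>p. p \<bind> P) ^^ t) (return_pmf S)"

definition d_TV :: "'a pmf \<Rightarrow> 'a pmf \<Rightarrow> real" where
  "d_TV p q = (SUP A. \<bar>measure_pmf.prob p A - measure_pmf.prob q A\<bar>)"

text \<open>
  The value is an extended natural number: an infimum over an empty set of times, that is
  a chain that never gets close to \<open>\<mu>\<close>, counts as \<open>\<infinity>\<close>.
\<close>

definition T_mix :: "'a set \<Rightarrow> ('a \<Rightarrow> 'a pmf) \<Rightarrow> 'a pmf \<Rightarrow> enat" where
  "T_mix X P \<mu> = (SUP S\<in>X. INF t\<in>{t. d_TV (chain_dist P t S) \<mu> \<le> 1 / 4}. enat t)"

text \<open>
  Inside \<open>O(\<dots>)\<close> the iterated logarithm is read as \<open>max 1 (log log x)\<close>: \<open>log log x\<close>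
  is negative for \<open>1 < x < e\<close> and undefined for \<open>x = 1\<close>, whereas a mixing time can be
  positive for such \<open>x\<close>.  The two agree for \<open>x \<ge> exp (exp 1)\<close>.
\<close>

definition loglog :: "real \<Rightarrow> real" where
  "loglog x = max 1 (ln (ln x))"

end

theory Submission
  imports Defs
begin

text \<open>
  The condition \<open>M\<^sub>S \<preceq> I\<close> says that the Hessian of \<open>ln (\<partial>\<^sup>S g)\<close> at the origin is negative
  semidefinite, where \<open>g\<close> is the generating polynomial of \<open>\<mu>\<close>. Since \<open>g\<close> is multi-affine, a Schur
  complement argument moves the evaluation point along one coordinate at a time, so all \<open>\<partial>\<^sup>S g\<close> are
  log-concave at \<open>(q, \<dots>, q)\<close> for \<open>q \<ge> 0\<close>. Delete each element of a random set independently with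
  probability \<open>q\<close>. The entropy relative to the thinned \<open>\<mu>\<close> is a function of \<open>q\<close> that vanishes at
  \<open>q = 1\<close>, and log-concavity makes it convex. Hence the entropy at \<open>q = 0\<close> is at most minus the
  derivative there, which is a modified log-Sobolev inequality for the continuous-time chain that
  deletes each element at rate \<open>1\<close> and adds \<open>i\<close> at rate \<open>r\<^sub>S(i)\<close>. Comparing Dirichlet forms yields
  one with constant \<open>\<rho> = 1 / (n * (1 + r\<^sub>m\<^sub>a\<^sub>x))\<close> for the Glauber dynamics.

  Such an inequality controls the resolvent of the chain, that is, the chain observed at a
  geometric time of mean \<open>1 / \<rho>\<close>: each resolvent step halves the entropy, so that
  \<open>O(log log (1 / \<mu>\<^sub>m\<^sub>i\<^sub>n))\<close> steps suffice. To return to a deterministic time, note that the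
  transition operator is positive semidefinite, so \<open>P\<^sup>k f\<close> varies slowly in \<open>k\<close> and its maximum over
  all \<open>k\<close> beyond a multiple of \<open>1 / \<rho>\<close> is small in \<open>L\<^sup>2\<close>; it is therefore harmless not to know the
  time at which the chain is close to equilibrium.
\<close>

section \<open>From a modified log-Sobolev inequality to discrete-time mixing\<close>

text \<open>Multiply \<open>ln z \<le> z - 1\<close> at \<open>z = 1 / sqrt y\<close> by
  \<open>2 * y\<close>. Summed against the weights, this bounds an entropy from below by a squared
  Hellinger distance.\<close>

lemma sqrt_entropy_bound:
  fixes y :: real
  assumes "0 < y"
  shows "(sqrt y - 1)\<^sup>2 \<le> y * ln y - y + 1"
proof -
  have "ln (1 / sqrt y) \<le> 1 / sqrt y - 1" by (rule ln_le_minus_one) (use assms in simp)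
  then have "1 - 1 / sqrt y \<le> ln y / 2" using assms by (simp add: ln_div ln_sqrt)
  then have "2 * y * (1 - 1 / sqrt y) \<le> 2 * y * (ln y / 2)"
    using assms by (intro mult_left_mono) auto
  moreover have "2 * y * (1 - 1 / sqrt y) = 2 * y - 2 * (y / sqrt y)" by (simp add: algebra_simps)
  moreover have "y / sqrt y = sqrt y" using assms by (simp add: real_div_sqrt)
  ultimately have "2 * y - 2 * sqrt y \<le> y * ln y" by simp
  then show ?thesis using assms by (simp add: power2_eq_square algebra_simps)
qed

section \<open>Finite reversible chains: the transition operator on functions\<close>

locale reversible_chain =
  fixes X :: "'a set" and m :: "'a \<Rightarrow> real" and p :: "'a \<Rightarrow> 'a \<Rightarrow> real"
  assumes finite_space: "finite X"
    and weight_pos: "x \<in> X \<Longrightarrow> 0 < m x"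
    and weight_total: "(\<Sum>x\<in>X. m x) = 1"
    and kernel_nonneg: "x \<in> X \<Longrightarrow> y \<in> X \<Longrightarrow> 0 \<le> p x y"
    and kernel_total: "x \<in> X \<Longrightarrow> (\<Sum>y\<in>X. p x y) = 1"
    and reversible: "x \<in> X \<Longrightarrow> y \<in> X \<Longrightarrow> m x * p x y = m y * p y x"
begin

definition step :: "('a \<Rightarrow> real) \<Rightarrow> 'a \<Rightarrow> real" where
  "step f x = (\<Sum>y\<in>X. p x y * f y)"

definition inner :: "('a \<Rightarrow> real) \<Rightarrow> ('a \<Rightarrow> real) \<Rightarrow> real" where
  "inner f g = (\<Sum>x\<in>X. m x * f x * g x)"

definition ent :: "('a \<Rightarrow> real) \<Rightarrow> real" where
  "ent f = (\<Sum>x\<in>X. m x * (f x * ln (f x)))"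

lemma step_cong: "(\<And>x. x \<in> X \<Longrightarrow> f x = g x) \<Longrightarrow> step f = step g"
  by (simp add: step_def fun_eq_iff)

lemma inner_cong:
  "(\<And>x. x \<in> X \<Longrightarrow> f x = f' x) \<Longrightarrow> (\<And>x. x \<in> X \<Longrightarrow> g x = g' x) \<Longrightarrow> inner f g = inner f' g'"
  by (simp add: inner_def)

lemma inner_commute: "inner f g = inner g f"
  by (simp add: inner_def mult_ac)

lemma inner_add_left: "inner (\<lambda>x. f x + g x) h = inner f h + inner g h"
  by (simp add: inner_def algebra_simps sum.distrib)

lemma inner_diff_left: "inner (\<lambda>x. f x - g x) h = inner f h - inner g h"
  by (simp add: inner_def algebra_simps sum_subtractf)

lemma inner_scale_left: "inner (\<lambda>x. c * f x) h = c * inner f h"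
  by (simp add: inner_def algebra_simps sum_distrib_left)

lemma inner_add_right: "inner h (\<lambda>x. f x + g x) = inner h f + inner h g"
  by (simp add: inner_def algebra_simps sum.distrib)

lemma inner_diff_right: "inner h (\<lambda>x. f x - g x) = inner h f - inner h g"
  by (simp add: inner_def algebra_simps sum_subtractf)

lemma inner_scale_right: "inner h (\<lambda>x. c * f x) = c * inner h f"
  by (simp add: inner_def algebra_simps sum_distrib_left)

lemmas inner_linear = inner_add_left inner_diff_left inner_scale_left
  inner_add_right inner_diff_right inner_scale_right

lemma inner_self_nonneg: "0 \<le> inner f f"
  unfolding inner_def using weight_pos
  by (intro sum_nonneg) (simp add: mult.assoc less_imp_le)

lemma step_diff: "step (\<lambda>x. f x - g x) = (\<lambda>x. step f x - step g x)"
  by (simp add: fun_eq_iff step_def algebra_simps sum_subtractf)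

lemma step_scale: "step (\<lambda>x. c * f x) = (\<lambda>x. c * step f x)"
  by (simp add: fun_eq_iff step_def algebra_simps sum_distrib_left)

lemma step_const: "x \<in> X \<Longrightarrow> step (\<lambda>_. c) x = c"
  by (simp add: step_def kernel_total flip: sum_distrib_right)

lemma step_mono:
  assumes "\<And>y. y \<in> X \<Longrightarrow> f y \<le> g y" "x \<in> X"
  shows "step f x \<le> step g x"
  unfolding step_def using assms kernel_nonneg by (intro sum_mono mult_left_mono) auto

lemma step_abs:
  assumes "x \<in> X"
  shows "\<bar>step f x\<bar> \<le> step (\<lambda>y. \<bar>f y\<bar>) x"
  unfolding step_def using assms kernel_nonneg
  by (intro order.trans[OF sum_abs] sum_mono) (simp add: abs_mult)

text \<open>Detailed balance makes the transition operator self-adjoint.\<close>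

lemma inner_step: "inner (step f) g = inner f (step g)"
proof -
  have "inner (step f) g = (\<Sum>x\<in>X. \<Sum>y\<in>X. m x * p x y * f y * g x)"
    by (simp add: inner_def step_def sum_distrib_left sum_distrib_right mult.assoc)
  also have "\<dots> = (\<Sum>y\<in>X. \<Sum>x\<in>X. m x * p x y * f y * g x)"
    by (rule sum.swap)
  also have "\<dots> = (\<Sum>y\<in>X. \<Sum>x\<in>X. m y * p y x * f y * g x)"
    by (intro sum.cong refl) (simp add: reversible)
  also have "\<dots> = inner f (step g)"
    by (simp add: inner_def step_def sum_distrib_left mult_ac)
  finally show ?thesis .
qed

lemma inner_step_const: "inner (step f) (\<lambda>_. c) = inner f (\<lambda>_. c)"
  unfolding inner_step by (rule inner_cong) (simp_all add: step_const)

lemma inner_iterate: "inner ((step ^^ i) f) ((step ^^ j) f) = inner ((step ^^ (i + j)) f) f"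
proof (induction j arbitrary: i)
  case (Suc j)
  have "inner ((step ^^ i) f) ((step ^^ Suc j) f) = inner ((step ^^ Suc i) f) ((step ^^ j) f)"
    by (simp add: inner_step)
  also have "\<dots> = inner ((step ^^ (Suc i + j)) f) f" by (rule Suc.IH)
  finally show ?case by simp
qed simp

lemma inner_iterate_const: "inner ((step ^^ k) f) (\<lambda>_. c) = inner f (\<lambda>_. c)"
  by (induction k) (simp_all add: inner_step_const)

lemma iterate_mono:
  assumes "\<And>y. y \<in> X \<Longrightarrow> f y \<le> g y" "x \<in> X"
  shows "(step ^^ k) f x \<le> (step ^^ k) g x"
  using assms(2) by (induction k arbitrary: x) (auto intro: assms(1) step_mono)

lemma iterate_const: "x \<in> X \<Longrightarrow> (step ^^ k) (\<lambda>_. c) x = c"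
proof (induction k arbitrary: x)
  case (Suc k)
  have "step ((step ^^ k) (\<lambda>_. c)) = step (\<lambda>_. c)"
    by (rule step_cong) (rule Suc.IH)
  then show ?case using Suc.prems by (simp add: step_const)
qed simp

lemma iterate_nonneg:
  assumes "\<And>y. y \<in> X \<Longrightarrow> 0 \<le> f y" "x \<in> X"
  shows "0 \<le> (step ^^ k) f x"
  using iterate_mono[of "\<lambda>_. 0" f x k] iterate_const[of x k 0] assms by simp

lemma iterate_abs:
  assumes "x \<in> X"
  shows "\<bar>(step ^^ k) f x\<bar> \<le> (step ^^ k) (\<lambda>y. \<bar>f y\<bar>) x"
  using assms
proof (induction k arbitrary: x)
  case (Suc k)
  have "\<bar>step ((step ^^ k) f) x\<bar> \<le> step (\<lambda>y. \<bar>(step ^^ k) f y\<bar>) x"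
    by (rule step_abs) fact
  also have "\<dots> \<le> step ((step ^^ k) (\<lambda>y. \<bar>f y\<bar>)) x"
    by (rule step_mono) (use Suc in auto)
  finally show ?case by simp
qed simp

lemma iterate_bound:
  assumes "\<And>y. y \<in> X \<Longrightarrow> \<bar>f y\<bar> \<le> c" "x \<in> X"
  shows "\<bar>(step ^^ k) f x\<bar> \<le> c"
  using iterate_abs[OF assms(2)] iterate_mono[of "\<lambda>y. \<bar>f y\<bar>" "\<lambda>_. c" x k] iterate_const assms
  by (metis order.trans)

lemma iterate_step: "(step ^^ k) (step f) = (step ^^ Suc k) f"
  by (simp add: funpow_swap1)

lemma iterate_lin:
  "(step ^^ k) (\<lambda>x. c * f x - d * g x) = (\<lambda>x. c * (step ^^ k) f x - d * (step ^^ k) g x)"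
  by (induction k) (simp_all add: step_diff step_scale)

lemma cauchy_schwarz: "(\<Sum>x\<in>X. m x * \<bar>f x * g x\<bar>) \<le> sqrt (inner f f) * sqrt (inner g g)"
proof -
  have "(\<Sum>x\<in>X. m x * \<bar>f x * g x\<bar>) = (\<Sum>x\<in>X. \<bar>sqrt (m x) * f x\<bar> * \<bar>sqrt (m x) * g x\<bar>)"
  proof (intro sum.cong refl)
    fix x assume "x \<in> X"
    then have "0 < m x" by (rule weight_pos)
    then have "sqrt (m x) * sqrt (m x) = m x" by simp
    then show "m x * \<bar>f x * g x\<bar> = \<bar>sqrt (m x) * f x\<bar> * \<bar>sqrt (m x) * g x\<bar>"
      using \<open>0 < m x\<close> by (simp add: abs_mult algebra_simps)
  qed
  also have "\<dots> \<le> L2_set (\<lambda>x. sqrt (m x) * f x) X * L2_set (\<lambda>x. sqrt (m x) * g x) X"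
    by (rule L2_set_mult_ineq)
  also have L2: "L2_set (\<lambda>x. sqrt (m x) * h x) X = sqrt (inner h h)" for h
    unfolding L2_set_def inner_def
    by (intro arg_cong[of _ _ sqrt] sum.cong refl)
      (simp add: power_mult_distrib weight_pos less_imp_le power2_eq_square mult.assoc)
  finally show ?thesis by (simp only: L2)
qed

section \<open>Resolvents of the chain\<close>

lemma resolvent_exists:
  assumes "0 < \<theta>"
  shows "\<exists>u. \<forall>x\<in>X. (1 + \<theta>) * u x - \<theta> * step u x = f x"
proof -
  \<comment> \<open>The solution is a Neumann series. As
    \<open>1 / (1 + \<theta>) = 1 - \<beta>\<close>, it averages \<open>(step ^^ N) f\<close> over a
    geometric time \<open>N\<close> that takes the value \<open>k\<close> with probability
    \<open>(1 - \<beta>) * \<beta> ^ k\<close> and has mean \<open>\<theta>\<close>.\<close>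
  define \<beta> where "\<beta> = \<theta> / (1 + \<theta>)"
  have \<beta>: "0 \<le> \<beta>" "\<beta> < 1" using assms by (simp_all add: \<beta>_def)
  define u where "u x = (\<Sum>k. \<beta> ^ k * (step ^^ k) f x) / (1 + \<theta>)" for x
  obtain M where M: "\<And>y. y \<in> X \<Longrightarrow> \<bar>f y\<bar> \<le> M"
  proof
    fix y assume "y \<in> X"
    then show "\<bar>f y\<bar> \<le> (\<Sum>y\<in>X. \<bar>f y\<bar>)"
      by (intro member_le_sum) (use finite_space in auto)
  qed
  have summ: "summable (\<lambda>k. \<beta> ^ k * (step ^^ k) f x)" if "x \<in> X" for x
  proof (rule summable_comparison_test')
    show "summable (\<lambda>k. \<beta> ^ k * M)"
      using \<beta> by (intro summable_mult2 summable_geometric) simp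
    show "norm (\<beta> ^ k * (step ^^ k) f x) \<le> \<beta> ^ k * M" if "k \<ge> 0" for k
      using iterate_bound[of f M x k] M \<open>x \<in> X\<close> \<beta>
      by (simp add: abs_mult mult_left_mono)
  qed
  have "(1 + \<theta>) * u x - \<theta> * step u x = f x" if x: "x \<in> X" for x
  proof -
    have "(1 + \<theta>) * step u x = (\<Sum>y\<in>X. p x y * (\<Sum>k. \<beta> ^ k * (step ^^ k) f y))"
      using assms unfolding step_def u_def sum_distrib_left by (intro sum.cong) auto
    also have "\<dots> = (\<Sum>y\<in>X. \<Sum>k. p x y * (\<beta> ^ k * (step ^^ k) f y))"
      by (intro sum.cong refl suminf_mult[symmetric] summ)
    also have "\<dots> = (\<Sum>k. \<Sum>y\<in>X. p x y * (\<beta> ^ k * (step ^^ k) f y))"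
      by (intro suminf_sum[symmetric] summable_mult summ)
    also have "\<dots> = (\<Sum>k. \<beta> ^ k * (step ^^ Suc k) f x)"
    proof (intro arg_cong[of _ _ suminf] ext)
      fix k
      show "(\<Sum>y\<in>X. p x y * (\<beta> ^ k * (step ^^ k) f y)) = \<beta> ^ k * (step ^^ Suc k) f x"
        unfolding funpow.simps comp_def step_def[of "(step ^^ k) f"] sum_distrib_left
        by (intro sum.cong) (auto simp: mult_ac)
    qed
    finally have 1: "(1 + \<theta>) * step u x = (\<Sum>k. \<beta> ^ k * (step ^^ Suc k) f x)" .
    have summ': "summable (\<lambda>k. \<beta> ^ k * (step ^^ Suc k) f x)"
    proof (rule summable_comparison_test')
      show "summable (\<lambda>k. \<beta> ^ k * M)"
        using \<beta> by (intro summable_mult2 summable_geometric) simp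
      show "norm (\<beta> ^ k * (step ^^ Suc k) f x) \<le> \<beta> ^ k * M" if "k \<ge> 0" for k
        using iterate_bound[of f M x "Suc k"] M x \<beta>
        by (simp add: abs_mult mult_left_mono del: funpow.simps)
    qed
    have "(\<Sum>k. \<beta> ^ k * (step ^^ k) f x)
        = f x + (\<Sum>k. \<beta> ^ Suc k * (step ^^ Suc k) f x)"
      using suminf_split_head[OF summ[OF x]] by simp
    also have "(\<Sum>k. \<beta> ^ Suc k * (step ^^ Suc k) f x) = \<beta> * (\<Sum>k. \<beta> ^ k * (step ^^ Suc k) f x)"
      using suminf_mult[OF summ', of \<beta>] by (simp add: mult_ac)
    finally have "(1 + \<theta>) * u x = f x + \<beta> * ((1 + \<theta>) * step u x)"
      using assms 1 by (simp add: u_def)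
    then show ?thesis using assms by (simp add: \<beta>_def)
  qed
  then show ?thesis by blast
qed

text \<open>The equation constrains \<open>u\<close> on \<open>X\<close> only, so a solution is
  chosen; its values outside \<open>X\<close> are arbitrary.\<close>

definition resolvent :: "real \<Rightarrow> ('a \<Rightarrow> real) \<Rightarrow> 'a \<Rightarrow> real" where
  "resolvent \<theta> f = (SOME u. \<forall>x\<in>X. (1 + \<theta>) * u x - \<theta> * step u x = f x)"

lemma resolvent_eq:
  assumes "0 < \<theta>" "x \<in> X"
  shows "(1 + \<theta>) * resolvent \<theta> f x - \<theta> * step (resolvent \<theta> f) x = f x"
  using someI_ex[OF resolvent_exists[OF assms(1)], of f] assms(2)
  unfolding resolvent_def by blast

text \<open>Minimum principle: at a minimiser \<open>z\<close> of the resolvent \<open>u\<close>,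
  averaging gives \<open>u z \<le> step u z\<close>, and the resolvent equation turns this into
  \<open>f z \<le> u z\<close>.\<close>

lemma resolvent_ge:
  assumes \<theta>: "0 < \<theta>" and f: "\<And>x. x \<in> X \<Longrightarrow> c \<le> f x" and x: "x \<in> X"
  shows "c \<le> resolvent \<theta> f x"
proof -
  let ?u = "resolvent \<theta> f"
  obtain z where z: "z \<in> X" "\<And>y. y \<in> X \<Longrightarrow> ?u z \<le> ?u y"
    using finite_space x
    by (metis (no_types, lifting) arg_min_if_finite(1) arg_min_least empty_iff)
  have "?u z = step (\<lambda>_. ?u z) z" using z by (simp add: step_const)
  also have "\<dots> \<le> step ?u z" by (rule step_mono) (use z in auto)
  finally have "\<theta> * ?u z \<le> \<theta> * step ?u z" using \<theta> by simp
  with resolvent_eq[OF \<theta> z(1), of f] f[OF z(1)] have "c \<le> ?u z"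
    by (simp add: algebra_simps)
  also have "\<dots> \<le> ?u x" using z x by simp
  finally show ?thesis .
qed

lemma resolvent_pos:
  assumes \<theta>: "0 < \<theta>" and f: "\<And>x. x \<in> X \<Longrightarrow> 0 < f x" and x: "x \<in> X"
  shows "0 < resolvent \<theta> f x"
proof -
  have "0 < Min (f ` X)" using finite_space x f by (subst Min_gr_iff) auto
  also have "\<dots> \<le> resolvent \<theta> f x"
    using finite_space x by (intro resolvent_ge \<theta>) auto
  finally show ?thesis .
qed

lemma inner_resolvent:
  assumes "0 < \<theta>"
  shows "inner (resolvent \<theta> f) g = inner f (resolvent \<theta> g)"
proof -
  let ?u = "resolvent \<theta> f" and ?v = "resolvent \<theta> g"
  have "inner ?u g = inner ?u (\<lambda>x. (1 + \<theta>) * ?v x - \<theta> * step ?v x)"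
    by (rule inner_cong) (simp_all add: resolvent_eq assms)
  also have "\<dots> = inner (\<lambda>x. (1 + \<theta>) * ?u x - \<theta> * step ?u x) ?v"
    by (simp add: inner_linear inner_step)
  also have "\<dots> = inner f ?v"
    by (rule inner_cong) (simp_all add: resolvent_eq assms)
  finally show ?thesis .
qed

lemma inner_resolvent_const:
  assumes "0 < \<theta>"
  shows "inner (resolvent \<theta> f) (\<lambda>_. c) = inner f (\<lambda>_. c)"
proof -
  let ?u = "resolvent \<theta> f"
  have "inner f (\<lambda>_. c) = inner (\<lambda>x. (1 + \<theta>) * ?u x - \<theta> * step ?u x) (\<lambda>_. c)"
    by (rule inner_cong) (simp_all add: resolvent_eq assms)
  also have "\<dots> = inner ?u (\<lambda>_. c)"
    by (simp add: inner_linear inner_step_const algebra_simps)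
  finally show ?thesis ..
qed

text \<open>A Pinsker-type bound: factor \<open>f - 1\<close> as
  \<open>(sqrt f - 1) * (sqrt f + 1)\<close> and apply Cauchy-Schwarz. The squared norms of the
  factors are at most \<open>ent f\<close> and \<open>4\<close>.\<close>

lemma l1_le_sqrt_ent:
  assumes f: "\<And>x. x \<in> X \<Longrightarrow> 0 < f x" and tot: "inner f (\<lambda>_. 1) = 1"
  shows "(\<Sum>x\<in>X. m x * \<bar>f x - 1\<bar>) \<le> 2 * sqrt (ent f)"
proof -
  have tot': "(\<Sum>x\<in>X. m x * f x) = 1" using tot by (simp add: inner_def)
  have "inner (\<lambda>x. sqrt (f x) - 1) (\<lambda>x. sqrt (f x) - 1) = (\<Sum>x\<in>X. m x * (sqrt (f x) - 1)\<^sup>2)"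
    by (simp add: inner_def power2_eq_square mult.assoc)
  also have "\<dots> \<le> (\<Sum>x\<in>X. m x * (f x * ln (f x) - f x + 1))"
    using weight_pos f sqrt_entropy_bound by (intro sum_mono mult_left_mono) (auto intro: less_imp_le)
  also have "\<dots> = ent f"
    using tot' weight_total by (simp add: ent_def algebra_simps sum.distrib sum_subtractf)
  finally have A: "inner (\<lambda>x. sqrt (f x) - 1) (\<lambda>x. sqrt (f x) - 1) \<le> ent f" .
  have "inner (\<lambda>x. sqrt (f x) + 1) (\<lambda>x. sqrt (f x) + 1) = (\<Sum>x\<in>X. m x * (sqrt (f x) + 1)\<^sup>2)"
    by (simp add: inner_def power2_eq_square mult.assoc)
  also have "\<dots> \<le> (\<Sum>x\<in>X. m x * (2 * f x + 2))"
  proof (intro sum_mono mult_left_mono)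
    fix x assume x: "x \<in> X"
    have "0 \<le> (sqrt (f x) - 1)\<^sup>2" by simp
    then show "(sqrt (f x) + 1)\<^sup>2 \<le> 2 * f x + 2"
      using f[OF x] by (simp add: power2_eq_square algebra_simps)
  qed (use weight_pos in \<open>auto intro: less_imp_le\<close>)
  also have "\<dots> = 2 * (\<Sum>x\<in>X. m x * f x) + 2 * (\<Sum>x\<in>X. m x)"
    by (simp add: algebra_simps sum.distrib sum_distrib_left sum_distrib_right)
  finally have B: "inner (\<lambda>x. sqrt (f x) + 1) (\<lambda>x. sqrt (f x) + 1) \<le> 4"
    using tot' weight_total by simp
  have "0 \<le> ent f" using A inner_self_nonneg order.trans by blast
  have "(\<Sum>x\<in>X. m x * \<bar>f x - 1\<bar>) = (\<Sum>x\<in>X. m x * \<bar>(sqrt (f x) - 1) * (sqrt (f x) + 1)\<bar>)"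
    using f by (intro sum.cong) (auto simp: algebra_simps less_imp_le)
  also have "\<dots> \<le> sqrt (ent f) * sqrt 4"
    using real_sqrt_le_mono[OF A] real_sqrt_le_mono[OF B] \<open>0 \<le> ent f\<close>
    by (intro order.trans[OF cauchy_schwarz] mult_mono real_sqrt_ge_zero inner_self_nonneg) auto
  finally show ?thesis by simp
qed

end

section \<open>Entropy decay of resolvents under a modified log-Sobolev inequality\<close>

locale mlsi_chain = reversible_chain +
  fixes \<rho> :: real
  assumes \<rho>_pos: "0 < \<rho>" and \<rho>_le: "\<rho> \<le> 1"
    and step_psd: "0 \<le> inner (step f) f"
    and gap: "inner f (\<lambda>_. 1) = 0 \<Longrightarrow> \<rho> / 10 * inner f f \<le> inner f f - inner (step f) f"
    and mlsi: "(\<And>x. x \<in> X \<Longrightarrow> 0 < h x) \<Longrightarrow> inner h (\<lambda>_. 1) = 1 \<Longrightarrow>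
      \<rho> * ent h \<le> inner h (\<lambda>x. ln (h x)) - inner (step h) (\<lambda>x. ln (h x))"
begin

text \<open>For the resolvent \<open>u\<close> of \<open>h\<close>, pair
  \<open>h = u + \<theta> * (u - step u)\<close> with \<open>ln u\<close>. By the log-Sobolev
  inequality one side is at least \<open>2 * ent u\<close>; by Gibbs' inequality, both masses being
  \<open>1\<close>, the other is at most \<open>ent h\<close>.\<close>

lemma ent_resolvent:
  assumes h: "\<And>x. x \<in> X \<Longrightarrow> 0 < h x" and tot: "inner h (\<lambda>_. 1) = 1"
  shows "ent (resolvent (1 / \<rho>) h) \<le> ent h / 2"
proof -
  define \<theta> where "\<theta> = 1 / \<rho>"
  have \<theta>: "0 < \<theta>" using \<rho>_pos by (simp add: \<theta>_def)
  define u where "u = resolvent \<theta> h"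
  have u: "0 < u x" if "x \<in> X" for x
    unfolding u_def using resolvent_pos[OF \<theta> h that] .
  have utot: "inner u (\<lambda>_. 1) = 1"
    using tot inner_resolvent_const[OF \<theta>] by (simp add: u_def)
  have eq: "h x = (1 + \<theta>) * u x - \<theta> * step u x" if "x \<in> X" for x
    using resolvent_eq[OF \<theta> that, of h] by (simp add: u_def)
  have ent_u: "ent u = inner u (\<lambda>x. ln (u x))"
    by (simp add: ent_def inner_def mult.assoc)
  have "ent u + ent u \<le> ent u + \<theta> * (inner u (\<lambda>x. ln (u x)) - inner (step u) (\<lambda>x. ln (u x)))"
    using mlsi[OF u utot] \<rho>_pos by (simp add: \<theta>_def field_simps)
  also have "\<dots> = inner (\<lambda>x. (1 + \<theta>) * u x - \<theta> * step u x) (\<lambda>x. ln (u x))"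
    unfolding inner_linear ent_u by (simp add: algebra_simps)
  also have "\<dots> = inner h (\<lambda>x. ln (u x))"
    by (rule inner_cong) (simp_all add: eq)
  also have "\<dots> = (\<Sum>x\<in>X. m x * (h x * ln (u x)))"
    by (simp add: inner_def mult.assoc)
  also have "\<dots> \<le> (\<Sum>x\<in>X. m x * (h x * ln (h x) + u x - h x))"
  proof (intro sum_mono mult_left_mono)
    fix x assume x: "x \<in> X"
    have "ln (u x / h x) \<le> u x / h x - 1"
      using u[OF x] h[OF x] by (intro ln_le_minus_one) simp
    then have "h x * ln (u x / h x) \<le> h x * (u x / h x - 1)"
      using h[OF x] by simp
    then show "h x * ln (u x) \<le> h x * ln (h x) + u x - h x"
      using h[OF x] u[OF x] by (simp add: ln_div algebra_simps)
  qed (use weight_pos in \<open>auto intro: less_imp_le\<close>)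
  also have "\<dots> = ent h + inner u (\<lambda>_. 1) - inner h (\<lambda>_. 1)"
    by (simp add: ent_def inner_def algebra_simps sum.distrib sum_subtractf)
  finally show ?thesis using tot utot by (simp add: u_def \<theta>_def)
qed

text \<open>One induction proves all three facts, since positivity and normalisation of an iterate
  are what \<open>ent_resolvent\<close> requires for the next.\<close>

lemma
  assumes h: "\<And>x. x \<in> X \<Longrightarrow> 0 < h x" and tot: "inner h (\<lambda>_. 1) = 1"
  shows resolvent_pow_pos: "x \<in> X \<Longrightarrow> 0 < (resolvent (1 / \<rho>) ^^ k) h x"
    and inner_resolvent_pow: "inner ((resolvent (1 / \<rho>) ^^ k) h) (\<lambda>_. 1) = 1"
    and ent_resolvent_pow: "ent ((resolvent (1 / \<rho>) ^^ k) h) \<le> ent h / 2 ^ k"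
proof -
  have \<theta>: "0 < 1 / \<rho>" using \<rho>_pos by simp
  let ?h = "\<lambda>k. (resolvent (1 / \<rho>) ^^ k) h"
  have *: "(\<forall>x\<in>X. 0 < ?h k x) \<and> inner (?h k) (\<lambda>_. 1) = 1 \<and> ent (?h k) \<le> ent h / 2 ^ k"
  proof (induction k)
    case (Suc k)
    then have pos: "\<And>x. x \<in> X \<Longrightarrow> 0 < ?h k x" and one: "inner (?h k) (\<lambda>_. 1) = 1" by auto
    have "ent (?h (Suc k)) \<le> ent (?h k) / 2"
      using ent_resolvent[OF pos one] by simp
    also have "\<dots> \<le> ent h / 2 ^ Suc k" using Suc by simp
    finally show ?case
      using resolvent_pos[OF \<theta> pos] inner_resolvent_const[OF \<theta>] one by simp
  qed (use h tot in auto)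
  show "x \<in> X \<Longrightarrow> 0 < ?h k x" "inner (?h k) (\<lambda>_. 1) = 1" "ent (?h k) \<le> ent h / 2 ^ k"
    using * by auto
qed

lemma inner_resolvent_pow_swap:
  "inner ((resolvent (1 / \<rho>) ^^ k) f) g = inner f ((resolvent (1 / \<rho>) ^^ k) g)"
proof (induction k arbitrary: g)
  case (Suc k)
  have "inner ((resolvent (1 / \<rho>) ^^ Suc k) f) g
      = inner ((resolvent (1 / \<rho>) ^^ k) f) (resolvent (1 / \<rho>) g)"
    using \<rho>_pos by (simp add: inner_resolvent)
  then show ?case using Suc.IH by (simp add: funpow_swap1)
qed simp

text \<open>
  The resolvent averages \<open>step ^^ N\<close> over a geometric time \<open>N\<close> of mean \<open>1 / \<rho>\<close>. If \<open>step ^^ j\<close>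
  of \<open>F\<close> is at least \<open>c\<close> up to time \<open>L\<close>, the affine bound \<open>c * (1 - j / L)\<close> holds at all times,
  and it shifts by the mean under the averaging: this is Markov's inequality for \<open>N\<close>.
\<close>
lemma resolvent_pow_lower:
  assumes F: "\<And>x. x \<in> X \<Longrightarrow> 0 \<le> F x" and x: "x \<in> X" and c: "0 \<le> c" and L: "0 < L"
    and low: "\<And>j. j \<le> L \<Longrightarrow> c \<le> (step ^^ j) F x"
  shows "c * (1 - (real j + real k / \<rho>) / real L)
    \<le> (step ^^ j) ((resolvent (1 / \<rho>) ^^ k) F) x"
proof (induction k arbitrary: j)
  case 0
  show ?case
  proof (cases "j \<le> L")
    case True
    have "c * (1 - real j / real L) \<le> c * 1"
      using c by (intro mult_left_mono) auto
    then show ?thesis using low[OF True] by simp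
  next
    case False
    then have "c * (1 - real j / real L) \<le> 0"
      using c L by (intro mult_nonneg_nonpos) auto
    also have "0 \<le> (step ^^ j) F x" using F x by (intro iterate_nonneg)
    finally show ?thesis by simp
  qed
next
  case (Suc k)
  define \<theta> where "\<theta> = 1 / \<rho>"
  have \<theta>: "0 < \<theta>" using \<rho>_pos by (simp add: \<theta>_def)
  have nonneg: "0 \<le> (resolvent \<theta> ^^ i) F y" if "y \<in> X" for y i
    using that by (induction i arbitrary: y) (auto intro: F resolvent_ge \<theta>)
  define u where "u = (resolvent \<theta> ^^ Suc k) F"
  define b where "b j = c * (1 - (real j + real (Suc k) * \<theta>) / real L)" for j
  have rec: "(1 + \<theta>) * (step ^^ j) u x - \<theta> * (step ^^ Suc j) u x
      = (step ^^ j) ((resolvent \<theta> ^^ k) F) x" for j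
  proof -
    have "(step ^^ j) ((resolvent \<theta> ^^ k) F) x = (step ^^ j) (\<lambda>y. (1 + \<theta>) * u y - \<theta> * step u y) x"
    proof (rule antisym)
      show "(step ^^ j) ((resolvent \<theta> ^^ k) F) x \<le> (step ^^ j) (\<lambda>y. (1 + \<theta>) * u y - \<theta> * step u y) x"
        "(step ^^ j) (\<lambda>y. (1 + \<theta>) * u y - \<theta> * step u y) x \<le> (step ^^ j) ((resolvent \<theta> ^^ k) F) x"
        by (rule iterate_mono; simp add: u_def resolvent_eq \<theta> x)+
    qed
    then show ?thesis by (simp add: iterate_lin iterate_step del: funpow.simps)
  qed
  \<comment> \<open>By \<open>rec\<close>, the value at \<open>j\<close> is a weighted mean of the
    case \<open>k\<close> at \<open>j\<close> and of the value at \<open>Suc j\<close>, so the bound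
    travels backwards in time. It starts from \<open>late\<close>, where the affine function is
    nonpositive.\<close>
  have shift: "b j \<le> (step ^^ j) u x" if "b (Suc j) \<le> (step ^^ Suc j) u x" for j
  proof -
    have "(1 + \<theta>) * b j = c * (1 - (real j + real k * \<theta>) / real L) + \<theta> * b (Suc j)"
      using L by (simp add: b_def field_simps)
    also have "\<dots> \<le> (step ^^ j) ((resolvent \<theta> ^^ k) F) x + \<theta> * (step ^^ Suc j) u x"
      using Suc.IH[of j] that \<theta> by (intro add_mono mult_left_mono) (auto simp: \<theta>_def)
    also have "\<dots> = (1 + \<theta>) * (step ^^ j) u x" using rec[of j] by linarith
    finally show ?thesis using \<theta> by simp
  qed
  have late: "b j \<le> (step ^^ j) u x" if "L \<le> j" for j
  proof -
    have "1 \<le> real j / real L" using that L by simp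
    also have "\<dots> \<le> (real j + real (Suc k) * \<theta>) / real L"
      using \<theta> by (intro divide_right_mono) auto
    finally have "b j \<le> 0" unfolding b_def using c by (intro mult_nonneg_nonpos) auto
    also have "0 \<le> (step ^^ j) u x"
      unfolding u_def using nonneg[of _ "Suc k"] x by (intro iterate_nonneg)
    finally show ?thesis .
  qed
  have "b j \<le> (step ^^ j) u x"
  proof (cases "L \<le> j")
    case False
    then have "j \<le> L" by simp
    then show ?thesis by (induction rule: inc_induct) (use late shift in auto)
  qed (rule late)
  then show ?case by (simp add: b_def u_def \<theta>_def)
qed

section \<open>Autocorrelations and a maximal inequality\<close>

definition corr :: "('a \<Rightarrow> real) \<Rightarrow> nat \<Rightarrow> real" where
  "corr f k = inner ((step ^^ k) f) f"

text \<open>As \<open>step\<close> is self-adjoint and positive semidefinite, \<open>corr f\<close>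
  is the moment sequence of a spectral measure on \<open>[0, 1]\<close>. Its monotonicity, convexity
  and decay are derived below without diagonalising.\<close>

lemma corr_iterate: "inner ((step ^^ i) f) ((step ^^ j) f) = corr f (i + j)"
  by (simp add: corr_def inner_iterate)

lemma corr_gap:
  assumes "inner f (\<lambda>_. 1) = 0"
  shows "\<rho> / 10 * corr f 0 \<le> corr f 0 - corr f 1"
  using gap[OF assms] by (simp add: corr_def)

lemma corr_psd: "0 \<le> corr f 1"
  using step_psd by (simp add: corr_def)

lemma corr_nonneg: "0 \<le> corr f 0"
  using inner_self_nonneg by (simp add: corr_def)

lemma corr_shift: "corr ((step ^^ i) f) k = corr f (2 * i + k)"
proof -
  have "corr ((step ^^ i) f) k = inner ((step ^^ (k + i)) f) ((step ^^ i) f)"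
    by (simp add: corr_def funpow_add)
  then show ?thesis by (simp add: corr_iterate mult_2 add_ac)
qed

text \<open>Squaring \<open>1 - step\<close> produces second differences, so facts about
  autocorrelations of \<open>f - step f\<close> become facts about the convexity of
  \<open>corr f\<close>.\<close>

lemma corr_diff:
  "corr (\<lambda>x. f x - step f x) k = corr f k - 2 * corr f (k + 1) + corr f (k + 2)"
proof -
  have it: "(step ^^ k) (\<lambda>x. f x - step f x) = (\<lambda>x. (step ^^ k) f x - (step ^^ Suc k) f x)"
    using iterate_lin[of k 1 f 1 "step f"] by (simp add: iterate_step del: funpow.simps)
  have "inner (g :: 'a \<Rightarrow> real) (step f) = inner (step g) f" for g
    by (simp add: inner_step)
  then show ?thesis
    unfolding corr_def it by (simp add: inner_linear)
qed

lemma mean_zero_iterate: "inner f (\<lambda>_. 1) = 0 \<Longrightarrow> inner ((step ^^ k) f) (\<lambda>_. 1) = 0"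
  by (simp add: inner_iterate_const)

lemma mean_zero_diff: "inner f (\<lambda>_. 1) = 0 \<Longrightarrow> inner (\<lambda>x. f x - step f x) (\<lambda>_. 1) = 0"
  by (simp add: inner_linear inner_step_const)

lemma corr_antimono_1:
  assumes f: "inner f (\<lambda>_. 1) = 0"
  shows "corr f 1 \<le> corr f 0"
proof -
  have "0 \<le> \<rho> / 10 * corr f 0" using \<rho>_pos corr_nonneg by simp
  then show ?thesis using corr_gap[OF f] by linarith
qed

text \<open>Positivity of \<open>step\<close> at \<open>f - step f\<close> gives
  \<open>corr f 2 - corr f 3 \<le> corr f 1 - corr f 2\<close>; the left side is nonnegative by
  \<open>corr_antimono_1\<close> at \<open>step f\<close>.\<close>

lemma corr_antimono_2:
  assumes f: "inner f (\<lambda>_. 1) = 0"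
  shows "corr f 2 \<le> corr f 1"
proof -
  have "0 \<le> corr f 1 - 2 * corr f 2 + corr f 3"
    using corr_psd[of "\<lambda>x. f x - step f x"] by (simp add: corr_diff numeral_eq_Suc)
  moreover have "corr f 3 \<le> corr f 2"
    using corr_antimono_1[OF mean_zero_iterate[OF f, of 1]] corr_shift[of 1 f]
    by (simp add: numeral_eq_Suc)
  ultimately show ?thesis by linarith
qed

text \<open>\<open>corr_shift\<close> absorbs an even number of steps into \<open>f\<close>, which
  leaves the indices \<open>0\<close> and \<open>1\<close>.\<close>

lemma corr_Suc_le:
  assumes f: "inner f (\<lambda>_. 1) = 0"
  shows "corr f (Suc k) \<le> corr f k"
proof (cases "even k")
  case True
  then obtain i where "k = 2 * i" by blast
  then show ?thesis
    using corr_antimono_1[OF mean_zero_iterate[OF f, of i]] by (simp add: corr_shift)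
next
  case False
  then obtain i where "k = 2 * i + 1" by (rule oddE)
  then show ?thesis
    using corr_antimono_2[OF mean_zero_iterate[OF f, of i]] by (simp add: corr_shift)
qed

text \<open>Of every two steps, the first gains a factor from the gap and the second only uses
  monotonicity.\<close>

lemma corr_decay:
  assumes f: "inner f (\<lambda>_. 1) = 0"
  shows "corr f (2 * k) \<le> (1 - \<rho> / 10) ^ k * corr f 0"
proof (induction k)
  case (Suc k)
  have "corr f (2 * Suc k) \<le> corr f (2 * k + 1)"
    using corr_Suc_le[OF f, of "2 * k + 1"] by simp
  also have "\<dots> \<le> (1 - \<rho> / 10) * corr f (2 * k)"
    using corr_gap[OF mean_zero_iterate[OF f, of k]] by (simp add: corr_shift algebra_simps)
  also have "\<dots> \<le> (1 - \<rho> / 10) * ((1 - \<rho> / 10) ^ k * corr f 0)"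
    using Suc \<rho>_le by (intro mult_left_mono) auto
  finally show ?case by simp
qed simp

text \<open>
  The second differences of \<open>corr f\<close> are nonnegative and decreasing, and they sum by parts to
  at most \<open>corr f 0\<close>. This replaces the spectral bound \<open>max {x ^ k * (1 - x)\<^sup>2} = O(1 / k\<^sup>2)\<close>.
\<close>
lemma corr_second_diff:
  assumes f: "inner f (\<lambda>_. 1) = 0"
  shows "(corr f k - 2 * corr f (k + 1) + corr f (k + 2)) * (real k * (real k + 1) / 2) \<le> corr f 0"
proof -
  define D where "D k = corr f k - 2 * corr f (k + 1) + corr f (k + 2)" for k
  have D: "D k = corr (\<lambda>x. f x - step f x) k" for k
    by (simp add: D_def corr_diff)
  have anti: "D (Suc k) \<le> D k" for k
    unfolding D by (rule corr_Suc_le) (rule mean_zero_diff[OF f])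
  have anti': "D k \<le> D j" if "j \<le> k" for j k
    using lift_Suc_antimono_le[of D, OF anti that] .
  \<comment> \<open>Summation by parts. The weights \<open>j + 1\<close> for \<open>j < k\<close>
    add up to \<open>k * (k + 1) / 2\<close>, and each multiplies some
    \<open>D j \<ge> D k\<close>.\<close>
  have parts: "(\<Sum>j<k. real (j + 1) * D j)
      = corr f 0 - corr f k - real k * (corr f k - corr f (k + 1))" for k
    by (induction k) (simp_all add: D_def algebra_simps)
  have nonneg: "0 \<le> corr f k" for k
  proof (cases "even k")
    case True
    then obtain i where "k = 2 * i" by blast
    then show ?thesis using corr_nonneg[of "(step ^^ i) f"] by (simp add: corr_shift)
  next
    case False
    then obtain i where "k = 2 * i + 1" by (rule oddE)
    then show ?thesis using corr_psd[of "(step ^^ i) f"] by (simp add: corr_shift)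
  qed
  have "real k * (real k + 1) / 2 = (\<Sum>j<k. real (j + 1))"
    by (induction k) (simp_all add: field_simps)
  then have "D k * (real k * (real k + 1) / 2) = (\<Sum>j<k. real (j + 1) * D k)"
    by (simp only: mult.commute[of "D k"] sum_distrib_right)
  also have "\<dots> \<le> (\<Sum>j<k. real (j + 1) * D j)"
    by (intro sum_mono mult_left_mono anti') auto
  also have "\<dots> \<le> corr f 0"
  proof -
    have "0 \<le> real k * (corr f k - corr f (k + 1))" using corr_Suc_le[OF f, of k] by simp
    then show ?thesis using nonneg[of k] unfolding parts by linarith
  qed
  finally show ?thesis by (simp add: D_def)
qed

text \<open>Write the difference of squares as \<open>?d * ?s\<close> and apply Cauchy-Schwarz. The
  squared norm of \<open>?d\<close> is a second difference of \<open>corr f\<close> at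
  \<open>2 * k\<close>, hence at most \<open>1 / k\<^sup>2\<close>; that of \<open>?s\<close> is at
  most \<open>4 * corr f (2 * k)\<close>, which decays geometrically.\<close>

lemma increment_norm:
  assumes f: "inner f (\<lambda>_. 1) = 0" and le: "corr f 0 \<le> 1" and k: "0 < k"
  shows "(\<Sum>x\<in>X. m x * \<bar>((step ^^ Suc k) f x)\<^sup>2 - ((step ^^ k) f x)\<^sup>2\<bar>)
    \<le> 2 / real k * (1 - \<rho> / 20) ^ k"
proof -
  let ?g = "\<lambda>k. (step ^^ k) f"
  let ?d = "\<lambda>x. ?g (Suc k) x - ?g k x" and ?s = "\<lambda>x. ?g (Suc k) x + ?g k x"
  have idx: "Suc k + Suc k = 2 * k + 2" "Suc k + k = 2 * k + 1" "k + Suc k = 2 * k + 1" "k + k = 2 * k"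
    by simp_all
  have "inner ?d ?d = corr f (2 * k) - 2 * corr f (2 * k + 1) + corr f (2 * k + 2)"
    unfolding inner_linear corr_iterate idx by simp
  also have "\<dots> \<le> (1 / real k)\<^sup>2"
  proof -
    let ?D = "corr f (2 * k) - 2 * corr f (2 * k + 1) + corr f (2 * k + 2)"
    have "?D * (real (2 * k) * (real (2 * k) + 1) / 2) \<le> 1"
      using corr_second_diff[OF f, of "2 * k"] le by linarith
    moreover have "0 \<le> ?D"
      using inner_self_nonneg[of ?d] \<open>inner ?d ?d = ?D\<close> by simp
    then have "?D * (real k)\<^sup>2 \<le> ?D * (real (2 * k) * (real (2 * k) + 1) / 2)"
      by (intro mult_left_mono) (auto simp: power2_eq_square algebra_simps)
    ultimately have "?D * (real k)\<^sup>2 \<le> 1" by linarith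
    then show ?thesis using k by (simp add: field_simps power2_eq_square)
  qed
  finally have d: "sqrt (inner ?d ?d) \<le> 1 / real k"
    by (intro real_le_lsqrt) auto
  have "inner ?s ?s = corr f (2 * k) + 2 * corr f (2 * k + 1) + corr f (2 * k + 2)"
    unfolding inner_linear corr_iterate idx by simp
  also have "\<dots> \<le> 4 * corr f (2 * k)"
    using corr_Suc_le[OF f, of "2 * k"] corr_Suc_le[OF f, of "2 * k + 1"] by simp
  also have "corr f (2 * k) \<le> (1 - \<rho> / 10) ^ k"
  proof -
    have "(1 - \<rho> / 10) ^ k * corr f 0 \<le> (1 - \<rho> / 10) ^ k * 1"
      using le \<rho>_le by (intro mult_left_mono) auto
    then show ?thesis using corr_decay[OF f, of k] by linarith
  qed
  \<comment> \<open>This turns the bound into a perfect square, so that its root is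
    explicit.\<close>
  also have "(1 - \<rho> / 10) ^ k \<le> ((1 - \<rho> / 20)\<^sup>2) ^ k"
  proof (rule power_mono)
    have "(1 - \<rho> / 20)\<^sup>2 = 1 - \<rho> / 10 + (\<rho> / 20)\<^sup>2"
      by (simp add: power2_eq_square algebra_simps)
    then show "1 - \<rho> / 10 \<le> (1 - \<rho> / 20)\<^sup>2" by simp
  qed (use \<rho>_le in simp)
  also have "4 * ((1 - \<rho> / 20)\<^sup>2) ^ k = (2 * (1 - \<rho> / 20) ^ k)\<^sup>2"
    by (simp only: power_mult_distrib power_mult[symmetric] mult.commute[of 2 k]) simp
  finally have "sqrt (inner ?s ?s) \<le> sqrt ((2 * (1 - \<rho> / 20) ^ k)\<^sup>2)"
    by (rule real_sqrt_le_mono) simp_all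
  moreover have "0 \<le> 2 * (1 - \<rho> / 20) ^ k" using \<rho>_le by simp
  ultimately have s: "sqrt (inner ?s ?s) \<le> 2 * (1 - \<rho> / 20) ^ k"
    by (simp only: real_sqrt_abs abs_of_nonneg)
  have "(\<Sum>x\<in>X. m x * \<bar>(?g (Suc k) x)\<^sup>2 - (?g k x)\<^sup>2\<bar>) = (\<Sum>x\<in>X. m x * \<bar>?d x * ?s x\<bar>)"
    by (intro sum.cong refl) (simp add: power2_eq_square algebra_simps)
  also have "\<dots> \<le> sqrt (inner ?d ?d) * sqrt (inner ?s ?s)"
    by (rule cauchy_schwarz)
  also have "\<dots> \<le> 1 / real k * (2 * (1 - \<rho> / 20) ^ k)"
    by (intro mult_mono d s real_sqrt_ge_zero inner_self_nonneg) simp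
  finally show ?thesis by simp
qed

text \<open>Telescoping dominates the squared maximum by its value at time \<open>a\<close> plus all
  later increments of the square. By \<open>increment_norm\<close> the increments contribute at most
  \<open>2 / a * (20 / \<rho>) \<le> 1 / 500\<close>, and the value at \<open>a\<close> at most
  \<open>1 / 2001\<close>.\<close>

lemma maximal_bound:
  assumes f: "inner f (\<lambda>_. 1) = 0" and le: "corr f 0 \<le> 1" and a: "20000 / \<rho> \<le> real a" and at: "a \<le> t"
  shows "(\<Sum>x\<in>X. m x * (Max ((\<lambda>k. \<bar>(step ^^ k) f x\<bar>) ` {a..t}))\<^sup>2) \<le> 1 / 256"
proof -
  let ?g = "\<lambda>k. (step ^^ k) f"
  let ?F = "\<lambda>x. Max ((\<lambda>k. \<bar>?g k x\<bar>) ` {a..t})"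
  have a_pos: "0 < a" and a\<rho>: "2000 \<le> real a * (\<rho> / 10)"
  proof -
    have "0 < 20000 / \<rho>" using \<rho>_pos by simp
    then show "0 < a" using a by linarith
    show "2000 \<le> real a * (\<rho> / 10)" using a \<rho>_pos by (simp add: field_simps)
  qed
  have pt: "(?F x)\<^sup>2 \<le> (?g a x)\<^sup>2 + (\<Sum>k\<in>{a..<t}. \<bar>(?g (Suc k) x)\<^sup>2 - (?g k x)\<^sup>2\<bar>)" for x
  proof -
    have "?F x \<in> (\<lambda>k. \<bar>?g k x\<bar>) ` {a..t}" using at by (intro Max_in) auto
    then obtain k where k: "k \<in> {a..t}" and Fk: "?F x = \<bar>?g k x\<bar>" by (rule imageE) auto
    have tel: "(\<Sum>i\<in>{a..<k}. (?g (Suc i) x)\<^sup>2 - (?g i x)\<^sup>2) = (?g k x)\<^sup>2 - (?g a x)\<^sup>2"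
      by (rule sum_Suc_diff') (use k in simp)
    have "(?g k x)\<^sup>2 = (?g a x)\<^sup>2 + (\<Sum>i\<in>{a..<k}. (?g (Suc i) x)\<^sup>2 - (?g i x)\<^sup>2)"
      unfolding tel by simp
    also have "\<dots> \<le> (?g a x)\<^sup>2 + (\<Sum>i\<in>{a..<k}. \<bar>(?g (Suc i) x)\<^sup>2 - (?g i x)\<^sup>2\<bar>)"
      by (intro add_left_mono sum_mono abs_ge_self)
    also have "\<dots> \<le> (?g a x)\<^sup>2 + (\<Sum>i\<in>{a..<t}. \<bar>(?g (Suc i) x)\<^sup>2 - (?g i x)\<^sup>2\<bar>)"
      using k by (intro add_left_mono sum_mono2) auto
    finally show ?thesis unfolding Fk by simp
  qed
  let ?I = "\<lambda>k. \<Sum>x\<in>X. m x * \<bar>(?g (Suc k) x)\<^sup>2 - (?g k x)\<^sup>2\<bar>"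
  have "(\<Sum>x\<in>X. m x * (?F x)\<^sup>2)
      \<le> (\<Sum>x\<in>X. m x * ((?g a x)\<^sup>2 + (\<Sum>k\<in>{a..<t}. \<bar>(?g (Suc k) x)\<^sup>2 - (?g k x)\<^sup>2\<bar>)))"
    using pt weight_pos by (intro sum_mono mult_left_mono) (auto intro: less_imp_le)
  also have "\<dots> = corr f (2 * a) + (\<Sum>k\<in>{a..<t}. ?I k)"
  proof -
    have "(\<Sum>x\<in>X. m x * (?g a x)\<^sup>2) = corr f (2 * a)"
      using corr_iterate[of a f a] by (simp add: inner_def power2_eq_square mult_2 mult.assoc)
    moreover have "(\<Sum>x\<in>X. m x * (\<Sum>k\<in>{a..<t}. \<bar>(?g (Suc k) x)\<^sup>2 - (?g k x)\<^sup>2\<bar>)) = (\<Sum>k\<in>{a..<t}. ?I k)"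
      unfolding sum_distrib_left by (rule sum.swap)
    ultimately show ?thesis by (simp only: distrib_left sum.distrib)
  qed
  also have "(\<Sum>k\<in>{a..<t}. ?I k) \<le> (\<Sum>k\<in>{a..<t}. 2 / real a * (1 - \<rho> / 20) ^ k)"
  proof (intro sum_mono)
    fix k assume k: "k \<in> {a..<t}"
    have "?I k \<le> 2 / real k * (1 - \<rho> / 20) ^ k"
      using k a_pos by (intro increment_norm[OF f le]) auto
    also have "\<dots> \<le> 2 / real a * (1 - \<rho> / 20) ^ k"
      using k a_pos \<rho>_le by (intro mult_right_mono divide_left_mono) auto
    finally show "?I k \<le> 2 / real a * (1 - \<rho> / 20) ^ k" .
  qed
  also have "\<dots> = 2 / real a * (\<Sum>k\<in>{a..<t}. (1 - \<rho> / 20) ^ k)"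
    by (simp add: sum_distrib_left)
  also have "\<dots> \<le> 2 / real a * (20 / \<rho>)"
  proof (intro mult_left_mono)
    have "(\<Sum>k\<in>{a..<t}. (1 - \<rho> / 20) ^ k) \<le> (\<Sum>k<t. (1 - \<rho> / 20) ^ k)"
      using \<rho>_le by (intro sum_mono2) auto
    also have "\<dots> = (1 - (1 - \<rho> / 20) ^ t) / (1 - (1 - \<rho> / 20))"
      using \<rho>_pos by (subst sum_gp_strict) auto
    also have "\<dots> \<le> 1 / (\<rho> / 20)"
      using \<rho>_pos \<rho>_le by (auto intro!: divide_right_mono)
    finally show "(\<Sum>k\<in>{a..<t}. (1 - \<rho> / 20) ^ k) \<le> 20 / \<rho>" by simp
  qed simp
  also have "\<dots> \<le> 1 / 500"
    using a\<rho> a_pos \<rho>_pos by (simp add: field_simps)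
  finally have 1: "(\<Sum>x\<in>X. m x * (?F x)\<^sup>2) \<le> corr f (2 * a) + 1 / 500" by simp
  have "(1 - \<rho> / 10) ^ a \<le> exp (- (\<rho> / 10)) ^ a"
    using \<rho>_le exp_ge_add_one_self[of "- (\<rho> / 10)"] by (intro power_mono) auto
  also have "\<dots> = 1 / exp (real a * (\<rho> / 10))"
    unfolding exp_of_nat_mult by (simp add: exp_minus inverse_eq_divide power_one_over)
  also have "\<dots> \<le> 1 / (1 + 2000)"
  proof (intro divide_left_mono)
    show "1 + 2000 \<le> exp (real a * (\<rho> / 10))"
      using exp_ge_add_one_self[of "real a * (\<rho> / 10)"] a\<rho> by linarith
  qed auto
  finally have "(1 - \<rho> / 10) ^ a * corr f 0 \<le> 1 / 2001 * 1"
    using le corr_nonneg by (intro mult_mono) auto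
  with corr_decay[OF f, of a] 1 show ?thesis by linarith
qed

text \<open>Let \<open>F\<close> be the maximal function over the times \<open>a\<close> to
  \<open>t = a + L\<close>. For every \<open>j \<le> L\<close>, \<open>(step ^^ j) F x\<close> is at
  least \<open>c\<close>, so averaging over \<open>k\<close> geometric times keeps
  \<open>R F x\<close> above \<open>c / 2\<close>. But \<open>R F x\<close> integrates
  \<open>F\<close> against a nearly stationary law, so it is close to the small mean of
  \<open>F\<close>. The maximum over times makes the actual random time irrelevant.\<close>

theorem mixing:
  assumes x: "x \<in> X" and m0: "0 < m0" "\<And>y. y \<in> X \<Longrightarrow> m0 \<le> m y"
    and f: "inner f (\<lambda>_. 1) = 0" "\<And>y. y \<in> X \<Longrightarrow> \<bar>f y\<bar> \<le> 1"
    and k: "ln (1 / m0) \<le> 2 ^ k / 4096"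
    and a: "20000 / \<rho> \<le> real a" and L: "2 * real k / \<rho> \<le> real L" "0 < L"
  shows "\<bar>(step ^^ (a + L)) f x\<bar> \<le> 1 / 4"
proof -
  define t where "t = a + L"
  define c where "c = \<bar>(step ^^ t) f x\<bar>"
  define F where "F y = Max ((\<lambda>k. \<bar>(step ^^ k) f y\<bar>) ` {a..t})" for y
  define R where "R = resolvent (1 / \<rho>) ^^ k"
  have at: "a \<le> t" by (simp add: t_def)
  have F_ge: "\<bar>(step ^^ i) f y\<bar> \<le> F y" if "a \<le> i" "i \<le> t" for i y
    unfolding F_def using that by (intro Max_ge) auto
  have F_nonneg: "0 \<le> F y" for y using F_ge[of a y] at by auto
  have F_le: "F y \<le> 1" if "y \<in> X" for y
    unfolding F_def using at iterate_bound[of f 1 y] f(2) that by (subst Max_le_iff) auto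
  have corr0: "corr f 0 \<le> 1"
  proof -
    have "(f y)\<^sup>2 \<le> 1" if "y \<in> X" for y using f(2)[OF that] by (simp add: abs_square_le_1)
    then have "(\<Sum>y\<in>X. m y * (f y)\<^sup>2) \<le> (\<Sum>y\<in>X. m y * 1)"
      using weight_pos by (intro sum_mono mult_left_mono) (auto intro: less_imp_le)
    then show ?thesis
      using weight_total by (simp add: corr_def inner_def power2_eq_square mult.assoc)
  qed
  have low: "c \<le> (step ^^ j) F x" if "j \<le> L" for j
  proof -
    have "(step ^^ (j + (t - j))) f = (step ^^ j) ((step ^^ (t - j)) f)"
      by (simp only: funpow_add comp_def)
    then have "c = \<bar>(step ^^ j) ((step ^^ (t - j)) f) x\<bar>"
      using that by (simp add: c_def t_def)
    also have "\<dots> \<le> (step ^^ j) (\<lambda>y. \<bar>(step ^^ (t - j)) f y\<bar>) x"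
      by (rule iterate_abs[OF x])
    also have "\<dots> \<le> (step ^^ j) F x"
      using that by (intro iterate_mono F_ge x) (auto simp: t_def)
    finally show ?thesis .
  qed
  have "c * (1 - (real 0 + real k / \<rho>) / real L) \<le> (step ^^ 0) ((resolvent (1 / \<rho>) ^^ k) F) x"
    by (rule resolvent_pow_lower[OF F_nonneg x _ L(2) low]) (simp_all add: c_def)
  then have c_le: "c * (1 - (real k / \<rho>) / real L) \<le> R F x" by (simp add: R_def)
  \<comment> \<open>The density of the half-and-half mixture of the point mass at \<open>x\<close>
    with equilibrium: the mixture makes it strictly positive, and \<open>inner_h0\<close> recovers
    the value at \<open>x\<close>.\<close>
  define h\<^sub>0 where "h\<^sub>0 y = (if y = x then 1 / (2 * m x) else 0) + 1 / 2" for y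
  define h where "h = R h\<^sub>0"
  have h0_pos: "0 < h\<^sub>0 y" for y using weight_pos[OF x] by (simp add: h\<^sub>0_def add_pos_pos)
  have inner_h0: "2 * inner h\<^sub>0 g = g x + inner (\<lambda>_. 1) g" for g
  proof -
    have "inner h\<^sub>0 g = (\<Sum>y\<in>X. (if y = x then g x / 2 else 0) + m y * g y / 2)"
      unfolding inner_def using weight_pos[OF x]
      by (intro sum.cong refl) (auto simp: h\<^sub>0_def field_simps)
    then show ?thesis
      using finite_space x by (simp add: sum.distrib inner_def flip: sum_divide_distrib)
  qed
  have one: "inner (\<lambda>_. 1) (\<lambda>_. 1) = 1" using weight_total by (simp add: inner_def)
  have h0_tot: "inner h\<^sub>0 (\<lambda>_. 1) = 1" using inner_h0[of "\<lambda>_. 1"] one by simp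
  \<comment> \<open>\<open>h\<^sub>0\<close> is at most \<open>1 / m0\<close>, which bounds its
    entropy by \<open>ln (1 / m0)\<close>. The choice of \<open>k\<close> brings this below
    \<open>(1 / 64)\<^sup>2\<close> after \<open>k\<close> halvings.\<close>
  have "ent h\<^sub>0 \<le> (\<Sum>y\<in>X. m y * (h\<^sub>0 y * ln (1 / m0)))"
    unfolding ent_def
  proof (intro sum_mono mult_left_mono)
    fix y assume y: "y \<in> X"
    have "m0 \<le> 1"
    proof -
      have "m x \<le> sum m X"
        by (rule member_le_sum) (use x finite_space weight_pos in \<open>auto intro: less_imp_le\<close>)
      then show ?thesis using m0(2)[OF x] weight_total by simp
    qed
    have "1 / (2 * m x) \<le> 1 / (2 * m0)"
      using m0 weight_pos[OF x] x by (intro divide_left_mono mult_pos_pos) auto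
    moreover have "1 / 2 \<le> 1 / (2 * m0)"
      using m0 \<open>m0 \<le> 1\<close> by (intro divide_left_mono) auto
    moreover have "0 < 1 / (2 * m0)" using m0(1) by simp
    moreover have "h\<^sub>0 y = 1 / (2 * m x) + 1 / 2 \<or> h\<^sub>0 y = 1 / 2"
      by (simp add: h\<^sub>0_def)
    ultimately have "h\<^sub>0 y \<le> 1 / (2 * m0) + 1 / (2 * m0)" by linarith
    then have "h\<^sub>0 y \<le> 1 / m0" by simp
    then show "ln (h\<^sub>0 y) \<le> ln (1 / m0)" using h0_pos[of y] by (intro ln_mono)
  qed (use h0_pos weight_pos in \<open>auto intro: less_imp_le\<close>)
  also have "\<dots> = inner h\<^sub>0 (\<lambda>_. 1) * ln (1 / m0)"
    by (simp add: inner_def sum_distrib_right mult.assoc)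
  also have "\<dots> \<le> 2 ^ k / 4096" using k h0_tot by simp
  finally have ent_h0: "ent h\<^sub>0 / 2 ^ k \<le> (1 / 64)\<^sup>2" by (simp add: field_simps power2_eq_square)
  have h_pos: "0 < h y" if "y \<in> X" for y
    unfolding h_def R_def by (rule resolvent_pow_pos[OF h0_pos h0_tot that])
  have h_tot: "inner h (\<lambda>_. 1) = 1"
    unfolding h_def R_def by (rule inner_resolvent_pow[OF h0_pos h0_tot])
  have "ent h \<le> (1 / 64)\<^sup>2"
    unfolding h_def R_def
    by (rule order.trans[OF ent_resolvent_pow[OF h0_pos h0_tot] ent_h0])
  then have "sqrt (ent h) \<le> 1 / 64"
    by (intro real_le_lsqrt) auto
  then have l1: "(\<Sum>y\<in>X. m y * \<bar>h y - 1\<bar>) \<le> 1 / 32"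
    using l1_le_sqrt_ent[OF h_pos h_tot] by simp
  \<comment> \<open>Solve \<open>inner_h0\<close> for the value at \<open>x\<close>, then move
    \<open>R\<close> onto \<open>h\<^sub>0\<close>. This leaves the mean of \<open>F\<close>, at
    most \<open>1 / 16\<close>, and an error of at most \<open>2 * (1 / 32)\<close>.\<close>
  have "R F x = 2 * inner h\<^sub>0 (R F) - inner (\<lambda>_. 1) (R F)"
    using inner_h0[of "R F"] by simp
  also have "inner h\<^sub>0 (R F) = inner h F"
    by (simp add: h_def R_def inner_resolvent_pow_swap)
  also have "inner (\<lambda>_. 1) (R F) = inner (\<lambda>_. 1) F"
  proof -
    have "inner ((resolvent (1 / \<rho>) ^^ i) F) (\<lambda>_. 1) = inner F (\<lambda>_. 1)" for i
      using \<rho>_pos by (induction i) (simp_all add: inner_resolvent_const)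
    then show ?thesis unfolding R_def by (metis inner_commute)
  qed
  also have "2 * inner h F - inner (\<lambda>_. 1) F
      = inner (\<lambda>_. 1) F + 2 * (\<Sum>y\<in>X. m y * ((h y - 1) * F y))"
    by (simp add: inner_def algebra_simps sum_subtractf)
  also have "\<dots> \<le> inner (\<lambda>_. 1) F + 2 * (\<Sum>y\<in>X. m y * \<bar>h y - 1\<bar>)"
  proof (intro add_left_mono mult_left_mono sum_mono)
    fix y assume y: "y \<in> X"
    have "(h y - 1) * F y \<le> \<bar>h y - 1\<bar> * F y"
      by (intro mult_right_mono abs_ge_self F_nonneg)
    also have "\<dots> \<le> \<bar>h y - 1\<bar> * 1"
      by (intro mult_left_mono F_le y) simp
    finally show "(h y - 1) * F y \<le> \<bar>h y - 1\<bar>" by simp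
  qed (use weight_pos in \<open>auto intro: less_imp_le\<close>)
  also have "inner (\<lambda>_. 1) F \<le> 1 / 16"
  proof -
    have "inner F F \<le> (1 / 16)\<^sup>2"
      using maximal_bound[OF f(1) corr0 a at]
      by (simp add: F_def inner_def power2_eq_square mult.assoc)
    then have "sqrt (inner F F) \<le> 1 / 16" by (intro real_le_lsqrt) auto
    moreover have "inner (\<lambda>_. 1) F = (\<Sum>y\<in>X. m y * \<bar>1 * F y\<bar>)"
      using F_nonneg by (simp add: inner_def)
    ultimately show ?thesis
      using cauchy_schwarz[of "\<lambda>_. 1" F] one by simp
  qed
  finally have "R F x \<le> 1 / 8" using l1 by linarith
  \<comment> \<open>The mean \<open>k / \<rho>\<close> of the total geometric time is at most half
    of \<open>L\<close>.\<close>
  moreover have "c * (1 / 2) \<le> c * (1 - (real k / \<rho>) / real L)"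
  proof (intro mult_left_mono)
    have "real k / \<rho> / real L \<le> 1 / 2"
      unfolding pos_divide_le_eq[OF of_nat_0_less_iff[THEN iffD2, OF L(2)]] using L(1) by linarith
    then show "1 / 2 \<le> 1 - real k / \<rho> / real L" by simp
  qed (simp add: c_def)
  ultimately have "c \<le> 1 / 4" using c_le by linarith
  then show ?thesis by (simp add: c_def t_def)
qed

end

section \<open>Log-concavity of multi-affine polynomials\<close>

text \<open>For the multi-affine polynomial \<open>g\<close> with coefficients \<open>c\<close>,
  this is the \<open>S\<close>-derivative of \<open>g\<close> at the point that is \<open>q\<close>
  on \<open>A\<close> and \<open>0\<close> elsewhere. If \<open>A\<close> is the ground set,
  \<open>(1 - q) ^ card S\<close> times it is the weight of \<open>S\<close> after deleting each
  element with probability \<open>q\<close>.\<close>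

definition superset_sum :: "'a set \<Rightarrow> ('a set \<Rightarrow> real) \<Rightarrow> real \<Rightarrow> 'a set \<Rightarrow> real" where
  "superset_sum A c q S = (\<Sum>T\<in>Pow (A - S). c (S \<union> T) * q ^ card T)"

lemma superset_sum_empty: "superset_sum {} c q S = c S"
  by (simp add: superset_sum_def)

lemma superset_sum_0:
  assumes "finite A"
  shows "superset_sum A c 0 S = c S"
proof -
  have "superset_sum A c 0 S = (\<Sum>T\<in>Pow (A - S). if T = {} then c S else 0)"
    unfolding superset_sum_def using assms
    by (intro sum.cong refl) (auto simp: power_0_left card_eq_0_iff dest: finite_subset)
  then show ?thesis using assms by simp
qed

text \<open>By multi-affinity, raising the coordinate \<open>k\<close> from \<open>0\<close> to
  \<open>q\<close> adds \<open>q\<close> times the \<open>k\<close>-derivative; a derivative already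
  taken in \<open>k\<close> does not depend on that coordinate.\<close>

lemma superset_sum_insert:
  assumes "finite A" "k \<notin> A"
  shows "superset_sum (insert k A) c q S
    = superset_sum A c q S + (if k \<in> S then 0 else q * superset_sum A c q (insert k S))"
proof (cases "k \<in> S")
  case True
  then have "insert k A - S = A - S" by auto
  then show ?thesis using True by (simp add: superset_sum_def)
next
  case False
  have "insert k A - S = insert k (A - S)" using False by auto
  then have "superset_sum (insert k A) c q S
      = (\<Sum>T\<in>Pow (A - S) \<union> insert k ` Pow (A - S). c (S \<union> T) * q ^ card T)"
    by (simp add: superset_sum_def Pow_insert)
  also have "\<dots> = superset_sum A c q S + (\<Sum>T\<in>insert k ` Pow (A - S). c (S \<union> T) * q ^ card T)"
    unfolding superset_sum_def using assms by (intro sum.union_disjoint) auto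
  also have "(\<Sum>T\<in>insert k ` Pow (A - S). c (S \<union> T) * q ^ card T)
      = (\<Sum>T\<in>Pow (A - S). c (S \<union> insert k T) * q ^ card (insert k T))"
  proof (subst sum.reindex)
    show "inj_on (insert k) (Pow (A - S))"
      using assms by (intro inj_onI) (metis DiffD1 Pow_iff insert_ident subset_iff)
  qed simp
  also have "\<dots> = (\<Sum>T\<in>Pow (A - S). q * (c (insert k S \<union> T) * q ^ card T))"
  proof (intro sum.cong refl)
    fix T assume "T \<in> Pow (A - S)"
    then have "finite T" "k \<notin> T" using assms finite_subset[of T "A - S"] by auto
    then show "c (S \<union> insert k T) * q ^ card (insert k T) = q * (c (insert k S \<union> T) * q ^ card T)"
      by simp
  qed
  also have "\<dots> = q * superset_sum A c q (insert k S)"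
  proof -
    have "A - insert k S = A - S" using assms by auto
    then show ?thesis by (simp add: superset_sum_def sum_distrib_left)
  qed
  finally show ?thesis using False by simp
qed

lemma superset_sum_deriv:
  assumes "finite A"
  shows "((\<lambda>q. superset_sum A c q S) has_real_derivative
    (\<Sum>i\<in>A - S. superset_sum A c q (insert i S))) (at q)"
  using assms
proof (induction A arbitrary: S rule: finite_induct)
  case empty
  then show ?case by (simp add: superset_sum_empty)
next
  case (insert k A)
  note eq = superset_sum_insert[OF insert.hyps]
  show ?case
  proof (cases "k \<in> S")
    case True
    then have "insert k A - S = A - S" by auto
    then show ?thesis using insert.IH[of S] True by (simp add: eq)
  next
    case False
    then have ins: "insert k A - S = insert k (A - S)" "A - insert k S = A - S"
      using insert.hyps by auto
    have "((\<lambda>q. superset_sum A c q S + q * superset_sum A c q (insert k S)) has_real_derivative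
        (\<Sum>i\<in>A - S. superset_sum A c q (insert i S))
        + (1 * superset_sum A c q (insert k S)
          + (\<Sum>i\<in>A - S. superset_sum A c q (insert i (insert k S))) * q)) (at q)"
      using insert.IH[of S] insert.IH[of "insert k S"]
      unfolding ins by (intro DERIV_add DERIV_mult DERIV_ident)
    moreover have "(\<Sum>i\<in>insert k A - S. superset_sum (insert k A) c q (insert i S))
        = (\<Sum>i\<in>A - S. superset_sum A c q (insert i S))
        + (1 * superset_sum A c q (insert k S)
          + (\<Sum>i\<in>A - S. superset_sum A c q (insert i (insert k S))) * q)"
    proof -
      have "(\<Sum>i\<in>A - S. superset_sum (insert k A) c q (insert i S))
          = (\<Sum>i\<in>A - S. superset_sum A c q (insert i S) + superset_sum A c q (insert i (insert k S)) * q)"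
        using insert.hyps False by (intro sum.cong refl) (auto simp: eq insert_commute)
      then show ?thesis
        using insert.hyps unfolding ins by (simp add: eq sum.distrib sum_distrib_right)
    qed
    ultimately show ?thesis using False by (simp add: eq)
  qed
qed

text \<open>
  If \<open>a S\<close> is the derivative at a point of a multi-affine polynomial with respect to the
  variables in \<open>S\<close>, this says that the Hessian of the logarithm of \<open>a S\<close> is negative semidefinite.
\<close>
definition log_concave_at :: "'a set \<Rightarrow> ('a set \<Rightarrow> real) \<Rightarrow> 'a set \<Rightarrow> bool" where
  "log_concave_at N a S \<longleftrightarrow> (\<forall>x.
     a S * (\<Sum>i\<in>N - S. \<Sum>j\<in>N - S. if i = j then 0 else a (insert i (insert j S)) * x i * x j)
       \<le> (\<Sum>i\<in>N - S. a (insert i S) * x i)\<^sup>2)"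

text \<open>The Schur complement step. Here \<open>h\<close> and \<open>c\<close> are a polynomial
  and its \<open>k\<close>-derivative, \<open>V\<close> and \<open>W\<close> their gradients and
  \<open>H\<close> and \<open>K\<close> their Hessians along the other coordinates, and
  \<open>s\<close> is the \<open>k\<close>-th entry of the direction. Optimising \<open>base\<close>
  over \<open>s\<close> bounds \<open>c * H\<close>; with \<open>link\<close> for \<open>K\<close>,
  all terms add up to the square on the right.\<close>

lemma quadratic_shift:
  fixes h c q s H K V W :: real
  assumes "0 \<le> h" "0 \<le> c" "0 \<le> q"
    and zero: "h = 0 \<Longrightarrow> c = 0" "c = 0 \<Longrightarrow> W = 0 \<and> K = 0"
    and base: "\<And>s. h * (H + 2 * s * W) \<le> (V + c * s)\<^sup>2"
    and link: "c * K \<le> W\<^sup>2"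
  shows "(h + q * c) * (H + 2 * s * W + q * K) \<le> (V + c * s + q * W)\<^sup>2"
proof (cases "c = 0")
  case True
  then show ?thesis using zero(2) base[of 0] by simp
next
  case False
  moreover have "h \<noteq> 0" using zero(1) False by blast
  ultimately have c: "0 < c" and h: "0 < h" using \<open>0 \<le> c\<close> \<open>0 \<le> h\<close> by auto
  \<comment> \<open>The minimiser of \<open>(V + c * s)\<^sup>2 - 2 * h * s * W\<close>, at which
    \<open>base\<close> is sharpest.\<close>
  define s' where "s' = (h * W / c - V) / c"
  have "V + c * s' = h * W / c" using c by (simp add: s'_def)
  then have "h * (H + 2 * s' * W) \<le> h * (h * W\<^sup>2 / c\<^sup>2)"
    using base[of s'] by (simp add: power2_eq_square mult_ac)
  then have "H + 2 * s' * W \<le> h * W\<^sup>2 / c\<^sup>2" using h by (rule mult_left_le_imp_le)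
  then have 1: "c * (H + 2 * s' * W) \<le> c * (h * W\<^sup>2 / c\<^sup>2)"
    by (rule mult_left_mono) (use c in simp)
  have 2: "c * (H + 2 * s' * W) = c * H + 2 * (h * W\<^sup>2 / c) - 2 * V * W"
    using c by (simp add: s'_def power2_eq_square distrib_left left_diff_distrib)
  have 3: "c * (h * W\<^sup>2 / c\<^sup>2) = h * W\<^sup>2 / c"
    using c by (simp add: power2_eq_square)
  have "x \<le> z - y" if "x + 2 * y - z \<le> y" for x y z :: real using that by simp
  from this[OF 1[unfolded 2 3]] have cH: "c * H \<le> 2 * V * W - h * W\<^sup>2 / c" .
  have K: "K \<le> W\<^sup>2 / c" using link c by (simp add: field_simps)
  have "(h + q * c) * (H + 2 * s * W + q * K)
      = h * (H + 2 * s * W) + q * (c * H + 2 * c * s * W) + q * h * K + q\<^sup>2 * (c * K)"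
    by (simp add: algebra_simps power2_eq_square)
  also have "\<dots> \<le> (V + c * s)\<^sup>2 + q * (2 * V * W - h * W\<^sup>2 / c + 2 * c * s * W)
      + q * h * (W\<^sup>2 / c) + q\<^sup>2 * W\<^sup>2"
  proof (intro add_mono base)
    show "q * (c * H + 2 * c * s * W) \<le> q * (2 * V * W - h * W\<^sup>2 / c + 2 * c * s * W)"
      using cH \<open>0 \<le> q\<close> by (intro mult_left_mono add_right_mono)
    show "q * h * K \<le> q * h * (W\<^sup>2 / c)"
      using K \<open>0 \<le> q\<close> h by (intro mult_left_mono) auto
    show "q\<^sup>2 * (c * K) \<le> q\<^sup>2 * W\<^sup>2"
      using link by (intro mult_left_mono) auto
  qed
  also have "\<dots> = (V + c * s + q * W)\<^sup>2"
    by (simp add: algebra_simps power2_eq_square)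
  finally show ?thesis .
qed

text \<open>Moving the evaluation point along the coordinate \<open>k\<close> preserves log-concavity.\<close>
lemma log_concave_shift:
  assumes fin: "finite N" and k: "k \<in> N" and S: "S \<subseteq> N" and q: "0 \<le> q"
    and nonneg: "\<And>T. T \<subseteq> N \<Longrightarrow> 0 \<le> a T"
    and hered: "\<And>T i. T \<subseteq> N \<Longrightarrow> i \<in> N \<Longrightarrow> a T = 0 \<Longrightarrow> a (insert i T) = 0"
    and lc: "\<And>T. T \<subseteq> N \<Longrightarrow> log_concave_at N a T"
  shows "log_concave_at N (\<lambda>T. a T + (if k \<in> T then 0 else q * a (insert k T))) S"
proof (cases "k \<in> S")
  case True
  then show ?thesis using lc[OF S] by (simp add: log_concave_at_def cong: if_cong)
next
  case False
  define M where "M = N - S - {k}"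
  have M: "N - S = insert k M" "N - insert k S = M" "k \<notin> M" "finite M"
    using k False fin by (auto simp: M_def)
  define c where "c = a (insert k S)"
  show ?thesis
    unfolding log_concave_at_def
  proof
    fix x :: "'a \<Rightarrow> real"
    let ?pair = "\<lambda>b (x :: 'a \<Rightarrow> real). \<Sum>i\<in>M. \<Sum>j\<in>M. if i = j then 0 else b i j * x i * x j"
    define H where "H = ?pair (\<lambda>i j. a (insert i (insert j S))) x"
    define K where "K = ?pair (\<lambda>i j. a (insert i (insert j (insert k S)))) x"
    define V where "V = (\<Sum>i\<in>M. a (insert i S) * x i)"
    define W where "W = (\<Sum>i\<in>M. a (insert i (insert k S)) * x i)"
    have lin: "(\<Sum>i\<in>N - S. b i * y i) = (\<Sum>i\<in>M. b i * y i) + b k * y k" for b y :: "'a \<Rightarrow> real"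
      using M by (simp add: add.commute)
    have quad: "(\<Sum>i\<in>N - S. \<Sum>j\<in>N - S. if i = j then 0 else b i j * y i * y j)
        = ?pair b y + 2 * y k * (\<Sum>i\<in>M. b i k * y i)"
      if sym: "\<And>i j. b i j = b j i" for b :: "'a \<Rightarrow> 'a \<Rightarrow> real" and y
    proof -
      have 1: "(\<Sum>j\<in>M. if k = j then 0 else b k j * y k * y j) = y k * (\<Sum>i\<in>M. b i k * y i)"
        unfolding sum_distrib_left using M(3) by (intro sum.cong refl) (auto simp: sym mult_ac)
      have 2: "(\<Sum>i\<in>M. if i = k then 0 else b i k * y i * y k) = y k * (\<Sum>i\<in>M. b i k * y i)"
        unfolding sum_distrib_left using M(3) by (intro sum.cong refl) (auto simp: mult_ac)
      show ?thesis
        unfolding M(1) using M(3,4) by (simp add: sum.distrib 1 2)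
    qed
    \<comment> \<open>Log-concavity at \<open>S\<close> in the direction \<open>x\<close> with its
      \<open>k\<close>-th entry replaced by \<open>s\<close>; \<open>link\<close> below is
      log-concavity at \<open>insert k S\<close>.\<close>
    have base: "a S * (H + 2 * s * W) \<le> (V + c * s)\<^sup>2" for s
    proof -
      let ?y = "x(k := s)"
      have pair: "?pair b ?y = ?pair b x" for b
        using M(3) by (intro sum.cong refl) auto
      have line: "(\<Sum>i\<in>M. b i * ?y i) = (\<Sum>i\<in>M. b i * x i)" for b :: "'a \<Rightarrow> real"
        using M(3) by (intro sum.cong refl) auto
      have "a S * (?pair (\<lambda>i j. a (insert i (insert j S))) ?y
            + 2 * ?y k * (\<Sum>i\<in>M. a (insert i (insert k S)) * ?y i))
          \<le> ((\<Sum>i\<in>M. a (insert i S) * ?y i) + a (insert k S) * ?y k)\<^sup>2"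
      proof -
        have "(\<Sum>i\<in>N - S. \<Sum>j\<in>N - S. if i = j then 0
              else a (insert i (insert j S)) * ?y i * ?y j)
            = ?pair (\<lambda>i j. a (insert i (insert j S))) ?y
              + 2 * ?y k * (\<Sum>i\<in>M. a (insert i (insert k S)) * ?y i)"
          by (rule quad) (metis insert_commute)
        then show ?thesis
          using lc[OF S, unfolded log_concave_at_def, rule_format, of ?y] by (simp only: lin)
      qed
      then show ?thesis
        unfolding pair line by (simp add: H_def W_def V_def c_def)
    qed
    have link: "c * K \<le> W\<^sup>2"
      using lc[of "insert k S"] S k by (auto simp: log_concave_at_def M(2) c_def K_def W_def)
    have zero: "W = 0 \<and> K = 0" if "c = 0"
    proof -
      have z: "a (insert i (insert k S)) = 0" if "i \<in> M" for i
        using hered[of "insert k S" i] S k \<open>c = 0\<close> that by (auto simp: c_def M_def)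
      have zz: "a (insert i (insert j (insert k S))) = 0" if "i \<in> M" "j \<in> M" for i j
        using hered[of "insert j (insert k S)" i] z[OF that(2)] S k that by (auto simp: M_def)
      show ?thesis by (auto simp: W_def K_def z zz intro!: sum.neutral)
    qed
    have quad': "(\<Sum>i\<in>N - S. \<Sum>j\<in>N - S. if i = j then 0 else
          (a (insert i (insert j S)) + (if k \<in> insert i (insert j S) then 0
            else q * a (insert k (insert i (insert j S))))) * x i * x j)
        = H + 2 * x k * W + q * K"
    proof -
      have 1: "?pair (\<lambda>i j. a (insert i (insert j S)) + (if k \<in> insert i (insert j S) then 0
            else q * a (insert k (insert i (insert j S))))) x = H + q * K"
        unfolding H_def K_def sum_distrib_left sum.distrib[symmetric]
        using M(3) False
        by (intro sum.cong refl) (auto simp: algebra_simps insert_commute)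
      show ?thesis
        by (subst quad) (auto simp: insert_commute 1 W_def)
    qed
    have lin': "(\<Sum>i\<in>N - S. (a (insert i S) + (if k \<in> insert i S then 0
          else q * a (insert k (insert i S)))) * x i) = V + c * x k + q * W"
    proof -
      have "(\<Sum>i\<in>M. (a (insert i S) + (if k \<in> insert i S then 0
          else q * a (insert k (insert i S)))) * x i) = V + q * W"
        unfolding V_def W_def sum_distrib_left sum.distrib[symmetric]
        using M(3) False by (intro sum.cong refl) (auto simp: algebra_simps insert_commute)
      then show ?thesis by (subst lin) (simp add: c_def)
    qed
    have "(a S + q * c) * (H + 2 * x k * W + q * K) \<le> (V + c * x k + q * W)\<^sup>2"
    proof (rule quadratic_shift[OF _ _ q _ zero base link])
      show "a S = 0 \<Longrightarrow> c = 0" using hered[OF S k] by (simp add: c_def)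
    qed (use nonneg S k in \<open>auto simp: c_def\<close>)
    then show "(a S + (if k \<in> S then 0 else q * a (insert k S)))
        * (\<Sum>i\<in>N - S. \<Sum>j\<in>N - S. if i = j then 0 else
            (a (insert i (insert j S)) + (if k \<in> insert i (insert j S) then 0
              else q * a (insert k (insert i (insert j S))))) * x i * x j)
        \<le> (\<Sum>i\<in>N - S. (a (insert i S) + (if k \<in> insert i S then 0
            else q * a (insert k (insert i S)))) * x i)\<^sup>2"
      unfolding quad' lin' using False by (simp add: c_def)
  qed
qed

text \<open>Induction over the set \<open>A\<close> of coordinates already raised to
  \<open>q\<close>. Nonnegativity and heredity of zeros are carried along because
  \<open>log_concave_shift\<close> uses them at each stage.\<close>

lemma log_concave_superset_sum:
  assumes fin: "finite N" and S: "S \<subseteq> N" and q: "0 \<le> q"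
    and nonneg: "\<And>T. T \<subseteq> N \<Longrightarrow> 0 \<le> a T"
    and hered: "\<And>T i. T \<subseteq> N \<Longrightarrow> i \<in> N \<Longrightarrow> a T = 0 \<Longrightarrow> a (insert i T) = 0"
    and lc: "\<And>T. T \<subseteq> N \<Longrightarrow> log_concave_at N a T"
  shows "log_concave_at N (superset_sum N a q) S"
proof -
  let ?u = "\<lambda>A. superset_sum A a q"
  have "(\<forall>T\<subseteq>N. 0 \<le> ?u A T \<and> log_concave_at N (?u A) T
      \<and> (\<forall>i\<in>N. ?u A T = 0 \<longrightarrow> ?u A (insert i T) = 0))" if "A \<subseteq> N" for A
    using finite_subset[OF that fin] that
  proof (induction A rule: finite_induct)
    case empty
    then show ?case using nonneg hered lc by (simp add: superset_sum_empty[abs_def])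
  next
    case (insert k A)
    then have k: "k \<in> N"
      and nn: "\<And>T. T \<subseteq> N \<Longrightarrow> 0 \<le> ?u A T"
      and he: "\<And>T i. T \<subseteq> N \<Longrightarrow> i \<in> N \<Longrightarrow> ?u A T = 0 \<Longrightarrow> ?u A (insert i T) = 0"
      and cc: "\<And>T. T \<subseteq> N \<Longrightarrow> log_concave_at N (?u A) T"
      by auto
    have eq: "?u (insert k A) = (\<lambda>T. ?u A T + (if k \<in> T then 0 else q * ?u A (insert k T)))"
      using superset_sum_insert[OF insert.hyps] by (simp add: fun_eq_iff)
    show ?case
    proof (intro allI impI conjI ballI)
      fix T assume T: "T \<subseteq> N"
      show "log_concave_at N (?u (insert k A)) T"
        unfolding eq by (rule log_concave_shift[OF fin k T q nn he cc])
      show "0 \<le> ?u (insert k A) T"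
        using nn T k q by (simp add: eq)
      fix i assume i: "i \<in> N" and z: "?u (insert k A) T = 0"
      have "?u A T = 0"
        using z nn[OF T] nn[of "insert k T"] T k q
        by (auto simp: eq add_nonneg_eq_0_iff split: if_splits)
      then have "?u A (insert i T) = 0" "?u A (insert k (insert i T)) = 0"
        using he[OF T i] he[of "insert i T" k] T i k by auto
      then show "?u (insert k A) (insert i T) = 0" by (simp add: eq)
    qed
  qed
  then show ?thesis using S by blast
qed

section \<open>Entropy of thinned measures\<close>

text \<open>
  The pairwise inequality behind the convexity of the entropy: with \<open>F = b / a\<close>, \<open>Fi = \<beta>i / \<alpha>i\<close>
  and \<open>Z = Fi * Fj / F\<close>, it is \<open>Fij * ln (Z / Fij) \<le> Z - Fij\<close>.
\<close>
lemma entropy_pair: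
  fixes a b \<alpha>i \<beta>i \<alpha>j \<beta>j \<alpha>ij \<beta>ij :: real
  assumes pos: "0 < a" "0 < b" "0 < \<alpha>i" "0 < \<beta>i" "0 < \<alpha>j" "0 < \<beta>j"
    and pair: "(0 < \<alpha>ij \<and> 0 < \<beta>ij) \<or> (\<alpha>ij = 0 \<and> \<beta>ij = 0)"
  shows "\<beta>ij * ((ln \<beta>i - ln \<alpha>i) - (ln b - ln a)) - \<beta>i * \<alpha>ij / \<alpha>i + \<alpha>ij * b / a
      - (\<beta>ij * ((ln \<beta>ij - ln \<alpha>ij) - (ln \<beta>j - ln \<alpha>j)) - \<beta>ij + \<alpha>ij * \<beta>j / \<alpha>j)
    \<le> b / a * (\<alpha>ij * (\<beta>i / \<alpha>i * a / b - 1) * (\<beta>j / \<alpha>j * a / b - 1))"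
  using pair
proof
  assume p: "0 < \<alpha>ij \<and> 0 < \<beta>ij"
  define Z where "Z = \<alpha>ij * \<beta>i * \<beta>j * a / (\<alpha>i * \<alpha>j * b)"
  have Z: "0 < Z" using pos p by (simp add: Z_def)
  have "ln (Z / \<beta>ij) \<le> Z / \<beta>ij - 1" using Z p by (intro ln_le_minus_one) simp
  then have "\<beta>ij * ln (Z / \<beta>ij) \<le> \<beta>ij * (Z / \<beta>ij - 1)" using p by simp
  then have *: "\<beta>ij * (ln Z - ln \<beta>ij) \<le> Z - \<beta>ij"
    using p Z by (simp add: ln_div right_diff_distrib)
  have lnZ: "ln Z = ln \<alpha>ij + ln \<beta>i + ln \<beta>j + ln a - ln \<alpha>i - ln \<alpha>j - ln b"
    using pos p by (simp add: Z_def ln_div ln_mult)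
  have rhs: "b / a * (\<alpha>ij * (\<beta>i / \<alpha>i * a / b - 1) * (\<beta>j / \<alpha>j * a / b - 1))
      = Z - \<beta>i * \<alpha>ij / \<alpha>i - \<alpha>ij * \<beta>j / \<alpha>j + \<alpha>ij * b / a"
    using pos by (simp add: Z_def field_simps)
  show ?thesis
    unfolding rhs using * unfolding lnZ by (simp add: algebra_simps)
qed simp

text \<open>Summing \<open>entropy_pair\<close> leaves the quadratic form of
  \<open>\<alpha>2\<close> at the relative increments \<open>x i\<close> of the density.
  Log-concavity in this direction bounds it by a square, which is the right side since
  \<open>\<beta> i - \<alpha> i * b / a = b / a * (\<alpha> i * x i)\<close>.\<close>

lemma entropy_local:
  fixes a b :: real and \<alpha> \<beta> :: "'a \<Rightarrow> real" and \<alpha>2 \<beta>2 :: "'a \<Rightarrow> 'a \<Rightarrow> real"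
  assumes pos: "0 < a" "0 < b" "\<And>i. i \<in> V \<Longrightarrow> 0 < \<alpha> i" "\<And>i. i \<in> V \<Longrightarrow> 0 < \<beta> i"
    and pair: "\<And>i j. i \<in> V \<Longrightarrow> j \<in> V \<Longrightarrow>
      (0 < \<alpha>2 i j \<and> 0 < \<beta>2 i j) \<or> (\<alpha>2 i j = 0 \<and> \<beta>2 i j = 0)"
    and lc: "\<And>x. a * (\<Sum>i\<in>V. \<Sum>j\<in>V. \<alpha>2 i j * x i * x j) \<le> (\<Sum>i\<in>V. \<alpha> i * x i)\<^sup>2"
  shows "(\<Sum>i\<in>V. \<Sum>j\<in>V. \<beta>2 i j * ((ln (\<beta> i) - ln (\<alpha> i)) - (ln b - ln a))
        - \<beta> i * \<alpha>2 i j / \<alpha> i + \<alpha>2 i j * b / a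
        - (\<beta>2 i j * ((ln (\<beta>2 i j) - ln (\<alpha>2 i j)) - (ln (\<beta> j) - ln (\<alpha> j))) - \<beta>2 i j
           + \<alpha>2 i j * \<beta> j / \<alpha> j))
    \<le> (\<Sum>i\<in>V. \<Sum>j\<in>V. (\<beta> i - \<alpha> i * b / a) * (\<beta> j - \<alpha> j * b / a)) / b"
proof -
  define x where "x i = \<beta> i / \<alpha> i * a / b - 1" for i
  have "?thesis \<longleftrightarrow> (\<Sum>i\<in>V. \<Sum>j\<in>V. \<beta>2 i j * ((ln (\<beta> i) - ln (\<alpha> i)) - (ln b - ln a))
        - \<beta> i * \<alpha>2 i j / \<alpha> i + \<alpha>2 i j * b / a
        - (\<beta>2 i j * ((ln (\<beta>2 i j) - ln (\<alpha>2 i j)) - (ln (\<beta> j) - ln (\<alpha> j))) - \<beta>2 i j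
           + \<alpha>2 i j * \<beta> j / \<alpha> j))
    \<le> b / (a * a) * (\<Sum>i\<in>V. \<alpha> i * x i)\<^sup>2"
  proof -
    have "\<beta> i - \<alpha> i * b / a = b / a * (\<alpha> i * x i)" if "i \<in> V" for i
      using pos(1,2) pos(3)[OF that] by (simp add: x_def field_simps)
    then have "(\<Sum>i\<in>V. \<Sum>j\<in>V. (\<beta> i - \<alpha> i * b / a) * (\<beta> j - \<alpha> j * b / a))
        = (\<Sum>i\<in>V. \<Sum>j\<in>V. (b / a * (\<alpha> i * x i)) * (b / a * (\<alpha> j * x j)))"
      by (intro sum.cong refl) simp
    also have "\<dots> = (\<Sum>i\<in>V. b / a * (\<alpha> i * x i)) * (\<Sum>j\<in>V. b / a * (\<alpha> j * x j))"
      by (rule sum_product[symmetric])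
    also have "\<dots> = (b / a)\<^sup>2 * (\<Sum>i\<in>V. \<alpha> i * x i)\<^sup>2"
      unfolding sum_distrib_left[symmetric] by (simp add: power2_eq_square)
    finally show ?thesis using pos(1,2) by (simp add: power2_eq_square)
  qed
  moreover have "(\<Sum>i\<in>V. \<Sum>j\<in>V. \<beta>2 i j * ((ln (\<beta> i) - ln (\<alpha> i)) - (ln b - ln a))
        - \<beta> i * \<alpha>2 i j / \<alpha> i + \<alpha>2 i j * b / a
        - (\<beta>2 i j * ((ln (\<beta>2 i j) - ln (\<alpha>2 i j)) - (ln (\<beta> j) - ln (\<alpha> j))) - \<beta>2 i j
           + \<alpha>2 i j * \<beta> j / \<alpha> j))
      \<le> (\<Sum>i\<in>V. \<Sum>j\<in>V. b / a * (\<alpha>2 i j * x i * x j))"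
    unfolding x_def using pos pair by (intro sum_mono entropy_pair) auto
  moreover have "\<dots> = b / (a * a) * (a * (\<Sum>i\<in>V. \<Sum>j\<in>V. \<alpha>2 i j * x i * x j))"
    using pos(1) by (simp add: sum_distrib_left mult_ac)
  moreover have "\<dots> \<le> b / (a * a) * (\<Sum>i\<in>V. \<alpha> i * x i)\<^sup>2"
    using pos lc by (intro mult_left_mono) auto
  ultimately show ?thesis by linarith
qed

section \<open>Weighted simplicial complexes and their thinning\<close>

locale log_concave_complex =
  fixes N :: "'a set" and X :: "'a set set" and m :: "'a set \<Rightarrow> real"
  assumes fin_ground: "finite N" and X_sub: "X \<subseteq> Pow N" and X_nonempty: "X \<noteq> {}"
    and X_down: "T \<in> X \<Longrightarrow> S \<subseteq> T \<Longrightarrow> S \<in> X"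
    and m_pos: "S \<in> X \<Longrightarrow> 0 < m S" and m_zero: "S \<notin> X \<Longrightarrow> m S = 0"
    and log_concave: "S \<in> X \<Longrightarrow> log_concave_at N m S"
begin

definition ext :: "'a set \<Rightarrow> 'a set" where
  "ext S = {i \<in> N - S. insert i S \<in> X}"

lemma finite_X: "finite X"
  using X_sub fin_ground finite_subset by blast

lemma finite_ext: "finite (ext S)"
  using fin_ground by (simp add: ext_def)

lemma finite_in_X: "S \<in> X \<Longrightarrow> finite S"
  using X_sub fin_ground finite_subset by blast

lemma extD: "i \<in> ext S \<Longrightarrow> i \<in> N" "i \<in> ext S \<Longrightarrow> i \<notin> S" "i \<in> ext S \<Longrightarrow> insert i S \<in> X"
  by (auto simp: ext_def)

lemma sum_ext:
  "(\<Sum>T\<in>X. \<Sum>i\<in>T. g i (T - {i}) T) = (\<Sum>S\<in>X. \<Sum>i\<in>ext S. g i S (insert i S))"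
proof -
  have "(\<Sum>T\<in>X. \<Sum>i\<in>T. g i (T - {i}) T) = (\<Sum>(T, i)\<in>(SIGMA T:X. T). g i (T - {i}) T)"
    using finite_X finite_in_X by (intro sum.Sigma) auto
  also have "\<dots> = (\<Sum>(S, i)\<in>(SIGMA S:X. ext S). g i S (insert i S))"
    using X_sub X_down
    by (intro sum.reindex_bij_witness[where i = "\<lambda>(S, i). (insert i S, i)"
          and j = "\<lambda>(T, i). (T - {i}, i)"]) (auto simp: ext_def insert_absorb)
  also have "\<dots> = (\<Sum>S\<in>X. \<Sum>i\<in>ext S. g i S (insert i S))"
    using finite_X finite_ext by (intro sum.Sigma[symmetric]) auto
  finally show ?thesis .
qed

lemma superset_sum_pos:
  assumes c: "\<And>T. T \<in> X \<Longrightarrow> 0 < c T" "\<And>T. T \<notin> X \<Longrightarrow> c T = 0" and S: "S \<in> X" and q: "0 \<le> q"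
  shows "0 < superset_sum N c q S"
proof -
  have nonneg: "0 \<le> c T" for T using c[of T] by (cases "T \<in> X") (auto intro: less_imp_le)
  have "0 < c S" using c(1)[OF S] .
  also have "c S = (\<Sum>T\<in>{{}}. c (S \<union> T) * q ^ card T)" by simp
  also have "\<dots> \<le> superset_sum N c q S"
    unfolding superset_sum_def using fin_ground nonneg q by (intro sum_mono2) auto
  finally show ?thesis .
qed

lemma superset_sum_outside:
  assumes c: "\<And>T. T \<notin> X \<Longrightarrow> c T = 0" and S: "S \<notin> X"
  shows "superset_sum N c q S = 0"
proof -
  have "c (S \<union> T) = 0" for T using c X_down[of "S \<union> T" S] S by blast
  then show ?thesis by (simp add: superset_sum_def)
qed

lemma superset_sum_deriv_ext:
  assumes c: "\<And>T. T \<notin> X \<Longrightarrow> c T = 0"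
  shows "((\<lambda>q. superset_sum N c q S) has_real_derivative
    (\<Sum>i\<in>ext S. superset_sum N c q (insert i S))) (at q)"
proof -
  have "(\<Sum>i\<in>ext S. superset_sum N c q (insert i S)) = (\<Sum>i\<in>N - S. superset_sum N c q (insert i S))"
    using fin_ground superset_sum_outside[of c, OF c]
    by (intro sum.mono_neutral_left) (auto simp: ext_def)
  then show ?thesis using superset_sum_deriv[OF fin_ground] by metis
qed

text \<open>Differentiating \<open>(1 - q) ^ card S\<close> yields one term per element
  \<open>i\<close> of \<open>S\<close>; \<open>sum_ext\<close> charges it to \<open>S - {i}\<close>,
  whose power of \<open>1 - q\<close> is the one that remains.\<close>

lemma thinning_deriv:
  assumes y: "\<And>S. S \<in> X \<Longrightarrow> (y S has_real_derivative y' S) (at q)"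
  shows "((\<lambda>q. \<Sum>S\<in>X. (1 - q) ^ card S * y S q) has_real_derivative
    (\<Sum>S\<in>X. (1 - q) ^ card S * (y' S - (\<Sum>i\<in>ext S. y (insert i S) q)))) (at q)"
proof -
  have "((\<lambda>q. \<Sum>S\<in>X. (1 - q) ^ card S * y S q) has_real_derivative
    (\<Sum>S\<in>X. (1 - q) ^ card S * y' S - real (card S) * (1 - q) ^ (card S - 1) * y S q)) (at q)"
    by (rule DERIV_sum) (auto intro!: derivative_eq_intros y)
  moreover have "(\<Sum>S\<in>X. real (card S) * (1 - q) ^ (card S - 1) * y S q)
      = (\<Sum>S\<in>X. \<Sum>i\<in>S. (1 - q) ^ card (S - {i}) * y S q)"
    using finite_in_X by (intro sum.cong refl) (simp add: card_Diff_singleton)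
  moreover have "\<dots> = (\<Sum>S\<in>X. \<Sum>i\<in>ext S. (1 - q) ^ card S * y (insert i S) q)"
    by (rule sum_ext[of "\<lambda>i S T. (1 - q) ^ card S * y T q"])
  ultimately show ?thesis
    by (simp add: sum_subtractf right_diff_distrib sum_distrib_left)
qed

lemma log_concave_thinned:
  assumes S: "S \<in> X" and q: "0 \<le> q"
  shows "log_concave_at N (superset_sum N m q) S"
proof (rule log_concave_superset_sum[OF fin_ground _ q])
  show "S \<subseteq> N" using S X_sub by auto
  show "0 \<le> m T" for T using m_pos m_zero by (cases "T \<in> X") (auto intro: less_imp_le)
  show "m (insert i T) = 0" if "m T = 0" for T i
    using that m_pos[of T] m_zero[of "insert i T"] X_down[of "insert i T" T] by force
  show "log_concave_at N m T" for T
    using log_concave m_zero[of T] by (cases "T \<in> X") (auto simp: log_concave_at_def)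
qed

section \<open>The entropy relative to the thinned measure as a function of \<open>q\<close>\<close>

context
  fixes f :: "'a set \<Rightarrow> real"
  assumes f_pos: "S \<in> X \<Longrightarrow> 0 < f S"
begin

abbreviation (input) "A \<equiv> \<lambda>S q. superset_sum N m q S"
abbreviation (input) "B \<equiv> \<lambda>S q. superset_sum N (\<lambda>T. m T * f T) q S"

text \<open>The log-density of the thinned \<open>m * f\<close> relative to the thinned
  \<open>m\<close>; the common factor \<open>(1 - q) ^ card S\<close> cancels.\<close>

definition logratio :: "'a set \<Rightarrow> real \<Rightarrow> real" where
  "logratio S q = ln (B S q) - ln (A S q)"

text \<open>With densities \<open>F\<close> at \<open>S\<close> and \<open>F'\<close> at
  \<open>insert i S\<close>, each summand is \<open>A (insert i S) q\<close> times the Bregman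
  divergence \<open>F' * ln (F' / F) - F' + F\<close>: the entropy lost by deleting
  \<open>i\<close>.\<close>

definition flux :: "'a set \<Rightarrow> real \<Rightarrow> real" where
  "flux S q = (\<Sum>i\<in>ext S. B (insert i S) q * (logratio (insert i S) q - logratio S q)
     - B (insert i S) q + A (insert i S) q * B S q / A S q)"

lemma A_pos: "S \<in> X \<Longrightarrow> 0 \<le> q \<Longrightarrow> 0 < A S q"
  by (rule superset_sum_pos) (simp_all add: m_pos m_zero)

lemma B_pos: "S \<in> X \<Longrightarrow> 0 \<le> q \<Longrightarrow> 0 < B S q"
  by (rule superset_sum_pos) (simp_all add: m_pos f_pos m_zero)

lemma A_deriv: "(A S has_real_derivative (\<Sum>i\<in>ext S. A (insert i S) q)) (at q)"
  by (rule superset_sum_deriv_ext) (simp add: m_zero)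

lemma B_deriv: "(B S has_real_derivative (\<Sum>i\<in>ext S. B (insert i S) q)) (at q)"
  by (rule superset_sum_deriv_ext) (simp add: m_zero)

lemma logratio_deriv:
  assumes "S \<in> X" "0 \<le> q"
  shows "(logratio S has_real_derivative
    (\<Sum>i\<in>ext S. B (insert i S) q) / B S q - (\<Sum>i\<in>ext S. A (insert i S) q) / A S q) (at q)"
  unfolding logratio_def
  by (auto intro!: derivative_eq_intros A_deriv B_deriv A_pos B_pos assms)

text \<open>The terms of \<open>flux\<close> without logarithm come from differentiating
  \<open>logratio\<close> under the factor \<open>B S\<close>.\<close>

lemma entropy_deriv:
  assumes q: "0 \<le> q"
  shows "((\<lambda>q. \<Sum>S\<in>X. (1 - q) ^ card S * (B S q * logratio S q)) has_real_derivative
    - (\<Sum>S\<in>X. (1 - q) ^ card S * flux S q)) (at q)"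
proof -
  let ?y' = "\<lambda>S. (\<Sum>i\<in>ext S. B (insert i S) q) * logratio S q
    + ((\<Sum>i\<in>ext S. B (insert i S) q) / B S q - (\<Sum>i\<in>ext S. A (insert i S) q) / A S q) * B S q"
  have y': "((\<lambda>q. B S q * logratio S q) has_real_derivative ?y' S) (at q)" if "S \<in> X" for S
    by (intro DERIV_mult B_deriv logratio_deriv that q)
  note D = thinning_deriv[of "\<lambda>S q. B S q * logratio S q" ?y', OF y']
  have "?y' S - (\<Sum>i\<in>ext S. B (insert i S) q * logratio (insert i S) q) = - flux S q"
    if "S \<in> X" for S
    using A_pos[OF that q] B_pos[OF that q]
    by (simp add: flux_def sum.distrib sum_subtractf sum_distrib_left sum_distrib_right
        left_diff_distrib right_diff_distrib sum_divide_distrib mult_ac)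
  then have "(\<Sum>S\<in>X. (1 - q) ^ card S
        * (?y' S - (\<Sum>i\<in>ext S. B (insert i S) q * logratio (insert i S) q)))
      = (\<Sum>S\<in>X. (1 - q) ^ card S * - flux S q)"
    by (intro sum.cong refl) simp
  also have "\<dots> = - (\<Sum>S\<in>X. (1 - q) ^ card S * flux S q)"
    by (simp add: sum_negf)
  finally show ?thesis using D by simp
qed

text \<open>This makes the derivative supplied by \<open>thinning_deriv\<close> nonpositive term by
  term, which is the convexity of the entropy. The derivative of \<open>flux S\<close> regroups into
  pair terms \<open>?g\<close> minus a product term \<open>?h / b\<close>;
  \<open>entropy_local\<close> compares them with the terms \<open>?f\<close> of the fluxes above
  \<open>S\<close>.\<close>

lemma flux_deriv:
  assumes S: "S \<in> X" and q: "0 \<le> q"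
  obtains D where "(flux S has_real_derivative D) (at q)" "D \<le> (\<Sum>j\<in>ext S. flux (insert j S) q)"
proof
  define V where "V = ext S"
  define a b where "a = A S q" and "b = B S q"
  define \<alpha> \<beta> where "\<alpha> i = A (insert i S) q" and "\<beta> i = B (insert i S) q" for i
  define \<alpha>2 where "\<alpha>2 i j = (if i = j then 0 else A (insert i (insert j S)) q)" for i j
  define \<beta>2 where "\<beta>2 i j = (if i = j then 0 else B (insert i (insert j S)) q)" for i j
  have ab: "0 < a" "0 < b" using A_pos[OF S q] B_pos[OF S q] by (simp_all add: a_def b_def)
  have \<alpha>\<beta>: "0 < \<alpha> i" "0 < \<beta> i" if "i \<in> V" for i
    using A_pos[of "insert i S" q] B_pos[of "insert i S" q] q that
    by (simp_all add: \<alpha>_def \<beta>_def V_def extD)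
  have outside: "A T q = 0" "B T q = 0" if "T \<notin> X" for T
    using that by (intro superset_sum_outside; simp add: m_zero)+
  have pair: "(0 < \<alpha>2 i j \<and> 0 < \<beta>2 i j) \<or> (\<alpha>2 i j = 0 \<and> \<beta>2 i j = 0)" for i j
    using A_pos[of "insert i (insert j S)" q] B_pos[of "insert i (insert j S)" q] q outside
    by (cases "insert i (insert j S) \<in> X") (simp_all add: \<alpha>2_def \<beta>2_def)
  have sym: "\<alpha>2 i j = \<alpha>2 j i" "\<beta>2 i j = \<beta>2 j i" for i j
    by (simp_all add: \<alpha>2_def \<beta>2_def insert_commute)
  \<comment> \<open>\<open>\<alpha>2\<close> and \<open>\<beta>2\<close> vanish on the diagonal and
    on pairs that do not extend \<open>S\<close> within \<open>X\<close>. With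
    \<open>G 0 0 = 0\<close>, all inner sums can run over the same set \<open>V\<close>.\<close>
  have nested: "(\<Sum>i\<in>ext (insert j S). G (B (insert i (insert j S)) q) (A (insert i (insert j S)) q))
      = (\<Sum>i\<in>V. G (\<beta>2 i j) (\<alpha>2 i j))" if "j \<in> V" "G 0 0 = 0" for G :: "real \<Rightarrow> real \<Rightarrow> real" and j
  proof -
    have sub: "ext (insert j S) \<subseteq> V"
    proof
      fix i assume "i \<in> ext (insert j S)"
      then show "i \<in> V"
        using X_down[of "insert i (insert j S)" "insert i S"] by (auto simp: V_def ext_def)
    qed
    have "(\<Sum>i\<in>ext (insert j S). G (B (insert i (insert j S)) q) (A (insert i (insert j S)) q))
        = (\<Sum>i\<in>ext (insert j S). G (\<beta>2 i j) (\<alpha>2 i j))"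
      by (intro sum.cong refl) (auto simp: \<alpha>2_def \<beta>2_def ext_def)
    also have "\<dots> = (\<Sum>i\<in>V. G (\<beta>2 i j) (\<alpha>2 i j))"
    proof (intro sum.mono_neutral_left sub ballI)
      show "finite V" by (simp add: V_def finite_ext)
      fix i assume i: "i \<in> V - ext (insert j S)"
      show "G (\<beta>2 i j) (\<alpha>2 i j) = 0"
      proof (cases "i = j")
        case True
        then show ?thesis by (simp add: \<alpha>2_def \<beta>2_def that)
      next
        case False
        then have "insert i (insert j S) \<notin> X" using i by (auto simp: V_def ext_def)
        then show ?thesis using outside by (simp add: \<alpha>2_def \<beta>2_def that)
      qed
    qed
    finally show ?thesis .
  qed
  let ?L = "ln b - ln a"
  let ?A1 = "\<Sum>j\<in>V. \<alpha> j" and ?B1 = "\<Sum>j\<in>V. \<beta> j"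
  let ?A2 = "\<lambda>i. \<Sum>j\<in>V. \<alpha>2 i j" and ?B2 = "\<lambda>i. \<Sum>j\<in>V. \<beta>2 i j"
  let ?D = "\<Sum>i\<in>V. ?B2 i * ((ln (\<beta> i) - ln (\<alpha> i)) - ?L)
      + ((?B2 i / \<beta> i - ?A2 i / \<alpha> i) - (?B1 / b - ?A1 / a)) * \<beta> i
      - ?B2 i + ((?A2 i * b + ?B1 * \<alpha> i) * a - \<alpha> i * b * ?A1) / (a * a)"
  have A2: "(\<Sum>j\<in>ext (insert i S). A (insert j (insert i S)) q) = ?A2 i" if "i \<in> V" for i
    using nested[OF that, of "\<lambda>b a. a"] unfolding sym(1)[of _ i] by simp
  have B2: "(\<Sum>j\<in>ext (insert i S). B (insert j (insert i S)) q) = ?B2 i" if "i \<in> V" for i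
    using nested[OF that, of "\<lambda>b a. b"] unfolding sym(2)[of _ i] by simp
  have dA1: "(A (insert i S) has_real_derivative ?A2 i) (at q)" if "i \<in> V" for i
    using A_deriv[of "insert i S" q] A2[OF that] by simp
  have dB1: "(B (insert i S) has_real_derivative ?B2 i) (at q)" if "i \<in> V" for i
    using B_deriv[of "insert i S" q] B2[OF that] by simp
  have dA: "(A S has_real_derivative ?A1) (at q)"
    using A_deriv[of S q] by (simp add: V_def \<alpha>_def)
  have dB: "(B S has_real_derivative ?B1) (at q)"
    using B_deriv[of S q] by (simp add: V_def \<beta>_def)
  have dL: "(logratio S has_real_derivative ?B1 / b - ?A1 / a) (at q)"
    using logratio_deriv[OF S q] by (simp add: V_def \<alpha>_def \<beta>_def a_def b_def)
  have dL1: "(logratio (insert i S) has_real_derivative ?B2 i / \<beta> i - ?A2 i / \<alpha> i) (at q)" if "i \<in> V" for i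
    using logratio_deriv[of "insert i S" q] that q A2[OF that] B2[OF that]
    by (simp add: V_def extD \<alpha>_def \<beta>_def)
  show "(flux S has_real_derivative ?D) (at q)"
    unfolding flux_def V_def[symmetric]
  proof (rule DERIV_sum)
    fix i assume i: "i \<in> V"
    have 1: "((\<lambda>q. B (insert i S) q * (logratio (insert i S) q - logratio S q)) has_real_derivative
        ?B2 i * (logratio (insert i S) q - logratio S q)
        + ((?B2 i / \<beta> i - ?A2 i / \<alpha> i) - (?B1 / b - ?A1 / a)) * B (insert i S) q) (at q)"
      by (intro DERIV_mult DERIV_diff dB1 dL1 dL i)
    have 2: "((\<lambda>q. A (insert i S) q * B S q / A S q) has_real_derivative
        ((?A2 i * B S q + ?B1 * A (insert i S) q) * A S q - A (insert i S) q * B S q * ?A1)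
          / (A S q * A S q)) (at q)"
      using ab(1) by (intro DERIV_divide DERIV_mult dA1 dB dA i) (simp add: a_def)
    show "((\<lambda>q. B (insert i S) q * (logratio (insert i S) q - logratio S q)
        - B (insert i S) q + A (insert i S) q * B S q / A S q) has_real_derivative
        ?B2 i * ((ln (\<beta> i) - ln (\<alpha> i)) - ?L)
        + ((?B2 i / \<beta> i - ?A2 i / \<alpha> i) - (?B1 / b - ?A1 / a)) * \<beta> i
        - ?B2 i + ((?A2 i * b + ?B1 * \<alpha> i) * a - \<alpha> i * b * ?A1) / (a * a)) (at q)"
      using DERIV_add[OF DERIV_diff[OF 1 dB1[OF i]] 2]
      unfolding logratio_def[of S] logratio_def[of "insert i S"]
        a_def[symmetric] b_def[symmetric] \<alpha>_def[symmetric] \<beta>_def[symmetric] .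
  qed
  let ?f = "\<lambda>i j. \<beta>2 i j * ((ln (\<beta>2 i j) - ln (\<alpha>2 i j)) - (ln (\<beta> j) - ln (\<alpha> j))) - \<beta>2 i j
      + \<alpha>2 i j * \<beta> j / \<alpha> j"
  let ?g = "\<lambda>i j. \<beta>2 i j * ((ln (\<beta> i) - ln (\<alpha> i)) - ?L) - \<beta> i * \<alpha>2 i j / \<alpha> i + \<alpha>2 i j * b / a"
  let ?h = "\<lambda>i j. (\<beta> i - \<alpha> i * b / a) * (\<beta> j - \<alpha> j * b / a)"
  have flux1: "(\<Sum>j\<in>ext S. flux (insert j S) q) = (\<Sum>i\<in>V. \<Sum>j\<in>V. ?f i j)"
  proof -
    have "flux (insert j S) q = (\<Sum>i\<in>V. ?f i j)" if j: "j \<in> V" for j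
      using nested[OF j, of "\<lambda>b a. b * ((ln b - ln a) - (ln (\<beta> j) - ln (\<alpha> j))) - b + a * \<beta> j / \<alpha> j"]
      by (simp add: flux_def logratio_def \<alpha>_def \<beta>_def)
    then have "(\<Sum>j\<in>ext S. flux (insert j S) q) = (\<Sum>j\<in>V. \<Sum>i\<in>V. ?f i j)"
      by (simp add: V_def)
    also have "\<dots> = (\<Sum>i\<in>V. \<Sum>j\<in>V. ?f i j)" by (rule sum.swap)
    finally show ?thesis .
  qed
  \<comment> \<open>The contributions from differentiating \<open>A S\<close> and \<open>B S\<close>
    themselves factor into the product \<open>?h / b\<close>.\<close>
  have "?D = (\<Sum>i\<in>V. \<Sum>j\<in>V. ?g i j - ?h i j / b)"
  proof (intro sum.cong refl)
    fix i assume i: "i \<in> V"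
    have lin: "(\<Sum>j\<in>V. x j * l - y j * u + y j * v - (z j - w j * s) * t)
        = (\<Sum>j\<in>V. x j) * l - (\<Sum>j\<in>V. y j) * u + (\<Sum>j\<in>V. y j) * v
          - ((\<Sum>j\<in>V. z j) - (\<Sum>j\<in>V. w j) * s) * t"
      for x y z w :: "'a \<Rightarrow> real" and l u v s t :: real
      by (simp only: sum.distrib sum_subtractf sum_distrib_right left_diff_distrib)
    have "(\<Sum>j\<in>V. ?g i j - ?h i j / b) = (\<Sum>j\<in>V. \<beta>2 i j * ((ln (\<beta> i) - ln (\<alpha> i)) - ?L)
        - \<alpha>2 i j * (\<beta> i / \<alpha> i) + \<alpha>2 i j * (b / a) - (\<beta> j - \<alpha> j * (b / a)) * ((\<beta> i - \<alpha> i * b / a) / b))"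
      by (intro sum.cong refl) (simp add: mult_ac)
    also have "\<dots> = ?B2 i * ((ln (\<beta> i) - ln (\<alpha> i)) - ?L) - ?A2 i * (\<beta> i / \<alpha> i) + ?A2 i * (b / a)
        - (?B1 - ?A1 * (b / a)) * ((\<beta> i - \<alpha> i * b / a) / b)"
      by (rule lin)
    also have "\<dots> = ?B2 i * ((ln (\<beta> i) - ln (\<alpha> i)) - ?L)
      + ((?B2 i / \<beta> i - ?A2 i / \<alpha> i) - (?B1 / b - ?A1 / a)) * \<beta> i
      - ?B2 i + ((?A2 i * b + ?B1 * \<alpha> i) * a - \<alpha> i * b * ?A1) / (a * a)"
    proof -
      have alg: "P * l - Q * (y / x) + Q * (b / a) - (P1 - Q1 * (b / a)) * ((y - x * b / a) / b)
          = P * l + ((P / y - Q / x) - (P1 / b - Q1 / a)) * y - P + ((Q * b + P1 * x) * a - x * b * Q1) / (a * a)"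
        if "0 < x" "0 < y" for P Q P1 Q1 l x y :: real
      proof -
      have 1: "(P / y - Q / x - (P1 / b - Q1 / a)) * y = P - Q * (y / x) - (P1 * (y / b) - Q1 * (y / a))"
        using that ab by (simp add: left_diff_distrib)
      have 2: "((Q * b + P1 * x) * a - x * b * Q1) / (a * a) = Q * (b / a) + P1 * (x / a) - Q1 * (x * b / (a * a))"
        using that ab by (simp add: diff_divide_distrib add_divide_distrib distrib_right mult_ac)
      have 3: "(P1 - Q1 * (b / a)) * ((y - x * b / a) / b)
          = P1 * (y / b) - P1 * (x / a) - Q1 * (y / a) + Q1 * (x * b / (a * a))"
        using that ab by (simp add: diff_divide_distrib left_diff_distrib right_diff_distrib mult_ac)
      show ?thesis unfolding 1 2 3 by simp
      qed
      show ?thesis by (rule alg) (use \<alpha>\<beta> i in auto)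
    qed
    finally show "?B2 i * ((ln (\<beta> i) - ln (\<alpha> i)) - ?L)
      + ((?B2 i / \<beta> i - ?A2 i / \<alpha> i) - (?B1 / b - ?A1 / a)) * \<beta> i
      - ?B2 i + ((?A2 i * b + ?B1 * \<alpha> i) * a - \<alpha> i * b * ?A1) / (a * a)
      = (\<Sum>j\<in>V. ?g i j - ?h i j / b)" ..
  qed
  also have "\<dots> = (\<Sum>i\<in>V. \<Sum>j\<in>V. ?g i j - ?f i j) + (\<Sum>i\<in>V. \<Sum>j\<in>V. ?f i j)
      - (\<Sum>i\<in>V. \<Sum>j\<in>V. ?h i j) / b"
    by (simp only: sum_subtractf sum_divide_distrib)
  also have "\<dots> \<le> (\<Sum>i\<in>V. \<Sum>j\<in>V. ?f i j)"
  proof -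
    have lc: "a * (\<Sum>i\<in>V. \<Sum>j\<in>V. \<alpha>2 i j * x i * x j) \<le> (\<Sum>i\<in>V. \<alpha> i * x i)\<^sup>2" for x
    proof -
      have fin: "finite (N - S)" and sub: "V \<subseteq> N - S"
        using fin_ground by (auto simp: V_def ext_def)
      have z: "A (insert i S) q = 0" if "i \<in> N - S - V" for i
        using that outside by (auto simp: V_def ext_def)
      have zz: "A (insert i (insert j S)) q = 0" if "i \<in> N - S - V \<or> j \<in> N - S - V" for i j
      proof -
        have "insert i (insert j S) \<notin> X"
          using that X_down[of "insert i (insert j S)" "insert i S"]
            X_down[of "insert i (insert j S)" "insert j S"] by (auto simp: V_def ext_def)
        then show ?thesis by (rule outside)
      qed
      have "(\<Sum>i\<in>V. \<alpha> i * x i) = (\<Sum>i\<in>N - S. A (insert i S) q * x i)"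
        unfolding \<alpha>_def using fin sub z by (intro sum.mono_neutral_left) auto
      moreover have "(\<Sum>i\<in>V. \<Sum>j\<in>V. \<alpha>2 i j * x i * x j)
          = (\<Sum>i\<in>N - S. \<Sum>j\<in>N - S. if i = j then 0 else A (insert i (insert j S)) q * x i * x j)"
      proof -
        have "(\<Sum>i\<in>V. \<Sum>j\<in>V. \<alpha>2 i j * x i * x j)
            = (\<Sum>i\<in>V. \<Sum>j\<in>N - S. if i = j then 0 else A (insert i (insert j S)) q * x i * x j)"
          unfolding \<alpha>2_def using fin sub zz
          by (intro sum.cong refl sum.mono_neutral_cong_left) auto
        also have "\<dots> = (\<Sum>i\<in>N - S. \<Sum>j\<in>N - S. if i = j then 0 else A (insert i (insert j S)) q * x i * x j)"
          using fin sub zz by (intro sum.mono_neutral_left ballI sum.neutral) auto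
        finally show ?thesis .
      qed
      ultimately show ?thesis
        using log_concave_thinned[OF S q] by (simp add: log_concave_at_def a_def)
    qed
    have "(\<Sum>i\<in>V. \<Sum>j\<in>V. ?g i j - ?f i j) \<le> (\<Sum>i\<in>V. \<Sum>j\<in>V. ?h i j) / b"
      by (rule entropy_local[OF ab \<alpha>\<beta> pair lc])
    then show ?thesis by linarith
  qed
  finally show "?D \<le> (\<Sum>j\<in>ext S. flux (insert j S) q)" by (simp only: flux1)
qed

text \<open>The entropy \<open>?E\<close> vanishes at \<open>1\<close>, so the mean value theorem
  gives \<open>?E 0 = ?K z\<close> for some \<open>z\<close> between \<open>0\<close> and
  \<open>1\<close>. As \<open>?K\<close> is nonincreasing by \<open>flux_deriv\<close>,
  \<open>?K z \<le> ?K 0\<close>.\<close>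

theorem entropy_le_flux:
  assumes tot: "(\<Sum>S\<in>X. m S) = 1" "(\<Sum>S\<in>X. m S * f S) = 1"
  shows "(\<Sum>S\<in>X. m S * (f S * ln (f S)))
    \<le> (\<Sum>S\<in>X. \<Sum>i\<in>ext S. m (insert i S)
          * (f (insert i S) * (ln (f (insert i S)) - ln (f S)) - f (insert i S) + f S))"
proof -
  let ?E = "\<lambda>q. \<Sum>S\<in>X. (1 - q) ^ card S * (B S q * logratio S q)"
  let ?K = "\<lambda>q. \<Sum>S\<in>X. (1 - q) ^ card S * flux S q"
  have lr0: "logratio S 0 = ln (f S)" if "S \<in> X" for S
    using m_pos[OF that] f_pos[OF that]
    by (simp add: logratio_def superset_sum_0 fin_ground ln_mult)
  have E0: "?E 0 = (\<Sum>S\<in>X. m S * (f S * ln (f S)))"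
    by (intro sum.cong refl) (simp add: lr0 superset_sum_0 fin_ground mult.assoc)
  have full: "superset_sum N c 1 {} = (\<Sum>S\<in>X. c S)" if "\<And>S. S \<notin> X \<Longrightarrow> c S = 0" for c
    unfolding superset_sum_def using X_sub fin_ground that
    by (auto intro!: sum.mono_neutral_right)
  \<comment> \<open>At \<open>q = 1\<close> only the empty set keeps a nonzero factor, and there
    both polynomials equal the total mass \<open>1\<close>.\<close>
  have E1: "?E 1 = 0"
  proof (intro sum.neutral ballI)
    fix S assume S: "S \<in> X"
    show "(1 - 1) ^ card S * (B S 1 * logratio S 1) = 0"
    proof (cases "S = {}")
      case True
      then show ?thesis using tot by (simp add: logratio_def full m_zero)
    next
      case False
      then have "card S \<noteq> 0" using finite_in_X[OF S] by simp
      then show ?thesis by simp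
    qed
  qed
  have K0: "?K 0 = (\<Sum>S\<in>X. \<Sum>i\<in>ext S. m (insert i S)
          * (f (insert i S) * (ln (f (insert i S)) - ln (f S)) - f (insert i S) + f S))"
  proof (intro sum.cong refl)
    fix S assume S: "S \<in> X"
    show "(1 - 0) ^ card S * flux S 0 = (\<Sum>i\<in>ext S. m (insert i S)
          * (f (insert i S) * (ln (f (insert i S)) - ln (f S)) - f (insert i S) + f S))"
      using S m_pos[OF S]
      by (auto simp: flux_def lr0 extD superset_sum_0 fin_ground algebra_simps intro!: sum.cong)
  qed
  have "\<exists>z. 0 < z \<and> z < 1 \<and> ?E 1 - ?E 0 = (1 - 0) * - ?K z"
  proof (rule MVT2[of 0 1 ?E "\<lambda>q. - ?K q"])
    fix q :: real assume "0 \<le> q"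
    then show "(?E has_real_derivative - ?K q) (at q)" by (rule entropy_deriv)
  qed simp
  then obtain z where z: "0 < z" "z < 1" "?E 1 - ?E 0 = - ?K z" by auto
  have "?K z \<le> ?K 0"
  proof (rule DERIV_nonpos_imp_nonincreasing[of 0 z ?K])
    fix q assume q: "0 \<le> q" "q \<le> z"
    have "\<exists>D. \<forall>S\<in>X. (flux S has_real_derivative D S) (at q)
        \<and> D S \<le> (\<Sum>j\<in>ext S. flux (insert j S) q)"
    proof (rule bchoice, rule ballI)
      fix S assume "S \<in> X"
      then obtain D where "(flux S has_real_derivative D) (at q)"
        "D \<le> (\<Sum>j\<in>ext S. flux (insert j S) q)"
        using q(1) by (rule flux_deriv)
      then show "\<exists>D. (flux S has_real_derivative D) (at q) \<and> D \<le> (\<Sum>j\<in>ext S. flux (insert j S) q)"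
        by blast
    qed
    then obtain D where D: "\<And>S. S \<in> X \<Longrightarrow> (flux S has_real_derivative D S) (at q)"
      "\<And>S. S \<in> X \<Longrightarrow> D S \<le> (\<Sum>j\<in>ext S. flux (insert j S) q)" by blast
    have "(?K has_real_derivative (\<Sum>S\<in>X. (1 - q) ^ card S
        * (D S - (\<Sum>i\<in>ext S. flux (insert i S) q)))) (at q)"
      by (rule thinning_deriv) (rule D)
    moreover have "(\<Sum>S\<in>X. (1 - q) ^ card S * (D S - (\<Sum>i\<in>ext S. flux (insert i S) q))) \<le> 0"
      using D(2) q z by (intro sum_nonpos mult_nonneg_nonpos) auto
    ultimately show "\<exists>y. (?K has_real_derivative y) (at q) \<and> y \<le> 0" by blast
  qed (use z in simp)
  then show ?thesis using z(3) E0 E1 K0 by simp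
qed

end

text \<open>With \<open>u = f (insert i S)\<close> and \<open>v = f S\<close>, the symmetric summand
  exceeds that of \<open>entropy_le_flux\<close> by
  \<open>u - v - v * (ln u - ln v) \<ge> 0\<close>. It is the one occurring in a Dirichlet form of
  \<open>f\<close> and \<open>ln f\<close>.\<close>

lemma mlsi_flux:
  assumes f: "\<And>S. S \<in> X \<Longrightarrow> 0 < f S"
    and tot: "(\<Sum>S\<in>X. m S) = 1" "(\<Sum>S\<in>X. m S * f S) = 1"
  shows "(\<Sum>S\<in>X. m S * (f S * ln (f S)))
    \<le> (\<Sum>S\<in>X. \<Sum>i\<in>ext S. m (insert i S)
          * ((f (insert i S) - f S) * (ln (f (insert i S)) - ln (f S))))"
proof (rule order.trans[OF entropy_le_flux[OF f tot]])
  show "(\<Sum>S\<in>X. \<Sum>i\<in>ext S. m (insert i S)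
          * (f (insert i S) * (ln (f (insert i S)) - ln (f S)) - f (insert i S) + f S))
    \<le> (\<Sum>S\<in>X. \<Sum>i\<in>ext S. m (insert i S)
          * ((f (insert i S) - f S) * (ln (f (insert i S)) - ln (f S))))"
  proof (intro sum_mono mult_left_mono)
    fix S i assume S: "S \<in> X" and i: "i \<in> ext S"
    define u v where "u = f (insert i S)" and "v = f S"
    have uv: "0 < u" "0 < v" using f S extD(3)[OF i] by (auto simp: u_def v_def)
    have "ln (u / v) \<le> u / v - 1" using uv by (intro ln_le_minus_one) simp
    then have "v * ln (u / v) \<le> v * (u / v - 1)" using uv by simp
    then have "v * (ln u - ln v) \<le> u - v" using uv by (simp add: ln_div right_diff_distrib)
    then show "f (insert i S) * (ln (f (insert i S)) - ln (f S)) - f (insert i S) + f S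
        \<le> (f (insert i S) - f S) * (ln (f (insert i S)) - ln (f S))"
      by (simp add: left_diff_distrib flip: u_def v_def)
    show "0 \<le> m (insert i S)" using m_pos extD(3)[OF i] by (simp add: less_imp_le)
  qed
qed

text \<open>The entropy inequality applied to \<open>1 + e * g\<close> for a small constant \<open>e\<close>.\<close>
lemma poincare_flux:
  assumes tot: "(\<Sum>S\<in>X. m S) = 1" and mean: "(\<Sum>S\<in>X. m S * g S) = 0"
  shows "(\<Sum>S\<in>X. m S * (g S)\<^sup>2) / 10
    \<le> (\<Sum>S\<in>X. \<Sum>i\<in>ext S. m (insert i S) * (g (insert i S) - g S)\<^sup>2)"
proof -
  define M where "M = 1 + (\<Sum>S\<in>X. \<bar>g S\<bar>)"
  have M: "0 < M" by (simp add: M_def sum_nonneg add_pos_nonneg)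
  have gM: "\<bar>g S\<bar> \<le> M" if "S \<in> X" for S
  proof -
    have "\<bar>g S\<bar> \<le> (\<Sum>S\<in>X. \<bar>g S\<bar>)" using that finite_X by (intro member_le_sum) auto
    then show ?thesis by (simp add: M_def)
  qed
  \<comment> \<open>This size keeps \<open>f\<close> between \<open>1 / 2\<close> and
    \<open>3 / 2\<close>.\<close>
  define e where "e = 1 / (2 * M)"
  have e: "0 < e" using M by (simp add: e_def)
  define f where "f S = 1 + e * g S" for S
  have f: "1 / 2 \<le> f S" "f S \<le> 3 / 2" if "S \<in> X" for S
  proof -
    have "e * \<bar>g S\<bar> \<le> e * M" using gM[OF that] e by simp
    also have "e * M = 1 / 2" using M by (simp add: e_def)
    finally have "\<bar>e * g S\<bar> \<le> 1 / 2" using e by (simp add: abs_mult)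
    then show "1 / 2 \<le> f S" "f S \<le> 3 / 2" unfolding f_def by linarith+
  qed
  have f_pos: "0 < f S" if "S \<in> X" for S using f(1)[OF that] by linarith
  have tot_f: "(\<Sum>S\<in>X. m S * f S) = 1"
  proof -
    have "(\<Sum>S\<in>X. m S * f S) = (\<Sum>S\<in>X. m S) + e * (\<Sum>S\<in>X. m S * g S)"
      by (simp add: f_def algebra_simps sum.distrib sum_distrib_left)
    then show ?thesis using tot mean by simp
  qed
  have "e\<^sup>2 * ((\<Sum>S\<in>X. m S * (g S)\<^sup>2) / 5) = (\<Sum>S\<in>X. m S * ((f S - 1)\<^sup>2 / 5))"
    by (simp add: f_def power_mult_distrib sum_distrib_left sum_divide_distrib mult_ac)
  also have "\<dots> \<le> (\<Sum>S\<in>X. m S * (f S * ln (f S) - f S + 1))"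
  proof (intro sum_mono mult_left_mono)
    fix S assume S: "S \<in> X"
    \<comment> \<open>Then \<open>f + 2 * sqrt f + 1 \<le> 3 / 2 + 5 / 2 + 1\<close>, which is the
      source of the factor \<open>1 / 5\<close>.\<close>
    have "sqrt (f S) \<le> 5 / 4"
      using f(2)[OF S] by (intro real_le_lsqrt) (auto simp: power2_eq_square)
    then have "(sqrt (f S) + 1)\<^sup>2 \<le> 5"
      using f[OF S] f_pos[OF S] by (simp add: power2_eq_square algebra_simps)
    then have "(sqrt (f S) - 1)\<^sup>2 * (sqrt (f S) + 1)\<^sup>2 \<le> (sqrt (f S) - 1)\<^sup>2 * 5"
      by (intro mult_left_mono) auto
    moreover have "(sqrt (f S) - 1)\<^sup>2 * (sqrt (f S) + 1)\<^sup>2 = (f S - 1)\<^sup>2"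
      using f_pos[OF S] by (simp add: algebra_simps less_imp_le flip: power_mult_distrib)
    ultimately show "(f S - 1)\<^sup>2 / 5 \<le> f S * ln (f S) - f S + 1"
      using sqrt_entropy_bound[OF f_pos[OF S]] by linarith
  qed (simp add: m_pos less_imp_le)
  also have "\<dots> = (\<Sum>S\<in>X. m S * (f S * ln (f S)))"
    using tot tot_f by (simp add: distrib_left right_diff_distrib sum.distrib sum_subtractf)
  also have "\<dots> \<le> (\<Sum>S\<in>X. \<Sum>i\<in>ext S. m (insert i S)
          * (f (insert i S) * (ln (f (insert i S)) - ln (f S)) - f (insert i S) + f S))"
    by (rule entropy_le_flux[OF f_pos tot tot_f])
  also have "\<dots> \<le> (\<Sum>S\<in>X. \<Sum>i\<in>ext S. m (insert i S) * (2 * (f (insert i S) - f S)\<^sup>2))"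
  proof (intro sum_mono mult_left_mono)
    fix S i assume S: "S \<in> X" and i: "i \<in> ext S"
    define u v where "u = f (insert i S)" and "v = f S"
    have uv: "0 < u" "0 < v" "1 / 2 \<le> v"
      using f_pos f(1) S extD(3)[OF i] by (auto simp: u_def v_def)
    have "ln (u / v) \<le> u / v - 1" using uv by (intro ln_le_minus_one) simp
    then have "u * (ln u - ln v) \<le> u * (u / v - 1)" using uv by (simp add: ln_div)
    then have "u * (ln u - ln v) - u + v \<le> (u - v)\<^sup>2 / v"
      using uv by (simp add: field_simps power2_eq_square)
    \<comment> \<open>The lower bound \<open>1 / 2\<close> on \<open>v\<close> costs a factor
      \<open>2\<close>; with \<open>1 / 5\<close> this makes \<open>1 / 10\<close>.\<close>
    also have "\<dots> \<le> (u - v)\<^sup>2 / (1 / 2)"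
      using uv by (intro divide_left_mono) auto
    finally show "f (insert i S) * (ln (f (insert i S)) - ln (f S)) - f (insert i S) + f S
        \<le> 2 * (f (insert i S) - f S)\<^sup>2"
      by (simp add: u_def v_def)
    show "0 \<le> m (insert i S)" using m_pos extD(3)[OF i] by (simp add: less_imp_le)
  qed
  also have "\<dots> = e\<^sup>2 * (2 * (\<Sum>S\<in>X. \<Sum>i\<in>ext S. m (insert i S) * (g (insert i S) - g S)\<^sup>2))"
  proof -
    have "(f T - f S)\<^sup>2 = e\<^sup>2 * (g T - g S)\<^sup>2" for S T
      by (simp add: f_def flip: right_diff_distrib power_mult_distrib)
    then show ?thesis by (simp add: sum_distrib_left mult_ac)
  qed
  finally have "(\<Sum>S\<in>X. m S * (g S)\<^sup>2) / 5
      \<le> 2 * (\<Sum>S\<in>X. \<Sum>i\<in>ext S. m (insert i S) * (g (insert i S) - g S)\<^sup>2)"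
    by (rule mult_left_le_imp_le) (use e in simp)
  then show ?thesis by simp
qed

end

section \<open>Glauber dynamics\<close>

text \<open>The expectation of \<open>f\<close> after resampling whether \<open>i\<close> belongs to
  the set.\<close>

definition site_update :: "'a set set \<Rightarrow> ('a set \<Rightarrow> real) \<Rightarrow> 'a \<Rightarrow> ('a set \<Rightarrow> real) \<Rightarrow> 'a set \<Rightarrow> real" where
  "site_update X m i f S =
     (if insert i S \<notin> X then f (S - {i})
      else (m (S - {i}) * f (S - {i}) + m (insert i S) * f (insert i S)) / (m (S - {i}) + m (insert i S)))"

context log_concave_complex
begin

text \<open>The equilibrium flow from \<open>S\<close> to \<open>insert i S\<close> when
  \<open>i\<close> is resampled; it equals the reverse flow.\<close>

definition edge_weight :: "'a set \<Rightarrow> 'a \<Rightarrow> real" where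
  "edge_weight S i = m S * m (insert i S) / (m S + m (insert i S))"

text \<open>Resampling \<open>i\<close> acts separately on each pair \<open>S\<close>,
  \<open>insert i S\<close> and on each set that cannot receive \<open>i\<close>.\<close>

lemma sum_site:
  assumes "i \<in> N"
  shows "(\<Sum>S\<in>X. g S) = (\<Sum>S\<in>{S \<in> X. i \<in> ext S}. g S + g (insert i S))
    + (\<Sum>S\<in>{S \<in> X. insert i S \<notin> X}. g S)"
proof -
  let ?Y = "{S \<in> X. i \<in> ext S}" and ?Z = "{S \<in> X. insert i S \<notin> X}"
  have "X = (?Y \<union> insert i ` ?Y) \<union> ?Z"
  proof (intro equalityI subsetI)
    fix S assume S: "S \<in> X"
    show "S \<in> (?Y \<union> insert i ` ?Y) \<union> ?Z"
    proof (cases "i \<in> S")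
      case True
      then have "S - {i} \<in> ?Y" "S = insert i (S - {i})"
        using S X_down[OF S, of "S - {i}"] assms by (auto simp: ext_def insert_absorb)
      then show ?thesis by blast
    qed (use S assms in \<open>auto simp: ext_def\<close>)
  qed (auto simp: ext_def)
  moreover have "(\<Sum>S\<in>(?Y \<union> insert i ` ?Y) \<union> ?Z. g S) = (\<Sum>S\<in>?Y. g S) + (\<Sum>S\<in>insert i ` ?Y. g S) + (\<Sum>S\<in>?Z. g S)"
    using finite_X by (subst sum.union_disjoint, simp, simp, force simp: ext_def)
      (subst sum.union_disjoint, auto simp: ext_def)
  moreover have "(\<Sum>S\<in>insert i ` ?Y. g S) = (\<Sum>S\<in>?Y. g (insert i S))"
  proof (subst sum.reindex)
    show "inj_on (insert i) ?Y"
      by (intro inj_onI) (metis (no_types, lifting) extD(2) insert_ident mem_Collect_eq)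
  qed simp
  ultimately show ?thesis by (simp add: sum.distrib)
qed

lemma site_update_pair:
  assumes "i \<in> ext S"
  shows "site_update X m i f S = (m S * f S + m (insert i S) * f (insert i S)) / (m S + m (insert i S))"
    and "site_update X m i f (insert i S) = (m S * f S + m (insert i S) * f (insert i S)) / (m S + m (insert i S))"
  using assms by (auto simp: site_update_def ext_def)

lemma site_update_fixed:
  assumes "insert i S \<notin> X" "S \<in> X"
  shows "site_update X m i f S = f S"
proof -
  have "i \<notin> S" using assms by (auto simp: insert_absorb)
  then show ?thesis using assms by (simp add: site_update_def)
qed

lemma site_dirichlet:
  assumes i: "i \<in> N"
  shows "(\<Sum>S\<in>X. m S * f S * g S) - (\<Sum>S\<in>X. m S * site_update X m i f S * g S)
    = (\<Sum>S\<in>{S \<in> X. i \<in> ext S}. edge_weight S i * ((f (insert i S) - f S) * (g (insert i S) - g S)))"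
proof -
  have "(\<Sum>S\<in>X. m S * f S * g S) - (\<Sum>S\<in>X. m S * site_update X m i f S * g S)
      = (\<Sum>S\<in>X. m S * (f S - site_update X m i f S) * g S)"
    by (simp add: right_diff_distrib left_diff_distrib sum_subtractf)
  also have "\<dots> = (\<Sum>S\<in>{S \<in> X. i \<in> ext S}. m S * (f S - site_update X m i f S) * g S
      + m (insert i S) * (f (insert i S) - site_update X m i f (insert i S)) * g (insert i S))"
    by (subst sum_site[OF i]) (simp add: site_update_fixed)
  also have "\<dots> = (\<Sum>S\<in>{S \<in> X. i \<in> ext S}.
      edge_weight S i * ((f (insert i S) - f S) * (g (insert i S) - g S)))"
  proof (intro sum.cong refl)
    fix S assume S: "S \<in> {S \<in> X. i \<in> ext S}"
    then have i: "i \<in> ext S" by simp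
    define s t where "s = m S" and "t = m (insert i S)"
    have "0 < s" "0 < t" using S m_pos extD(3)[OF i] by (auto simp: s_def t_def)
    then have d: "f S - (s * f S + t * f (insert i S)) / (s + t) = t * (f S - f (insert i S)) / (s + t)"
      "f (insert i S) - (s * f S + t * f (insert i S)) / (s + t) = s * (f (insert i S) - f S) / (s + t)"
      by (simp_all add: field_simps)
    show "m S * (f S - site_update X m i f S) * g S
      + m (insert i S) * (f (insert i S) - site_update X m i f (insert i S)) * g (insert i S)
      = edge_weight S i * ((f (insert i S) - f S) * (g (insert i S) - g S))"
      unfolding site_update_pair[OF i] edge_weight_def s_def[symmetric] t_def[symmetric] d
      by (simp add: divide_inverse algebra_simps)
  qed
  finally show ?thesis .
qed

text \<open>The update averages over each pair and fixes the remaining sets, so it is an orthogonal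
  projection; each block contributes a square.\<close>

lemma site_psd:
  assumes i: "i \<in> N"
  shows "0 \<le> (\<Sum>S\<in>X. m S * site_update X m i f S * f S)"
  unfolding sum_site[OF i]
proof (rule add_nonneg_nonneg; rule sum_nonneg)
  fix S assume S: "S \<in> {S \<in> X. i \<in> ext S}"
  then have i: "i \<in> ext S" by simp
  define s t where "s = m S" and "t = m (insert i S)"
  have st: "0 < s" "0 < t" using S m_pos extD(3)[OF i] by (auto simp: s_def t_def)
  have "m S * site_update X m i f S * f S
      + m (insert i S) * site_update X m i f (insert i S) * f (insert i S)
      = (s * f S + t * f (insert i S))\<^sup>2 / (s + t)"
    unfolding site_update_pair[OF i] s_def[symmetric] t_def[symmetric]
    using st by (simp add: add_divide_distrib power2_eq_square algebra_simps)
  then show "0 \<le> m S * site_update X m i f S * f S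
      + m (insert i S) * site_update X m i f (insert i S) * f (insert i S)"
    using st by simp
next
  fix S assume S: "S \<in> {S \<in> X. insert i S \<notin> X}"
  then have "0 < m S" using m_pos by simp
  then show "0 \<le> m S * site_update X m i f S * f S"
    using S by (simp add: site_update_fixed mult.assoc)
qed

lemma sum_sites:
  "(\<Sum>i\<in>N. \<Sum>S\<in>{S \<in> X. i \<in> ext S}. h S i) = (\<Sum>S\<in>X. \<Sum>i\<in>ext S. h S i)"
proof -
  have "(\<Sum>i\<in>N. \<Sum>S\<in>{S \<in> X. i \<in> ext S}. h S i) = (\<Sum>S\<in>X. \<Sum>i\<in>{i \<in> N. i \<in> ext S}. h S i)"
    using fin_ground finite_X by (rule sum.swap_restrict)
  moreover have "{i \<in> N. i \<in> ext S} = ext S" for S by (auto simp: ext_def)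
  ultimately show ?thesis by simp
qed

text \<open>The ratio bound gives \<open>m S + m (insert i S) \<le> (1 + R) * m S\<close>, so the
  conductances of the deletion chain exceed those of the site updates by at most the factor
  \<open>1 + R\<close>.\<close>

lemma edge_weight_ge:
  assumes S: "S \<in> X" and i: "i \<in> ext S" and R: "m (insert i S) \<le> R * m S" "0 \<le> R" and d: "0 \<le> d"
  shows "m (insert i S) * d \<le> (1 + R) * (edge_weight S i * d)"
proof -
  define s t where "s = m S" and "t = m (insert i S)"
  have st: "0 < s" "0 < t" using S m_pos extD(3)[OF i] by (auto simp: s_def t_def)
  have "t * (s + t) \<le> t * ((1 + R) * s)"
    using R(1) st by (intro mult_left_mono) (auto simp: s_def t_def algebra_simps)
  then have "t \<le> (1 + R) * (s * t / (s + t))"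
    using st by (simp add: field_simps)
  then have "t * d \<le> (1 + R) * (s * t / (s + t)) * d" using d by (rule mult_right_mono)
  then show ?thesis by (simp add: edge_weight_def mult.assoc flip: s_def t_def)
qed

end

section \<open>Glauber dynamics as a chain with a modified log-Sobolev inequality\<close>

locale glauber_chain = log_concave_complex "{1..n}" X "pmf \<mu>" for n X and \<mu> :: "nat set pmf" +
  fixes R :: real
  assumes n_pos: "0 < n" and R_nonneg: "0 \<le> R"
    and ratio_le: "S \<in> X \<Longrightarrow> i \<in> ext S \<Longrightarrow> pmf \<mu> (insert i S) \<le> R * pmf \<mu> S"
begin

abbreviation "\<rho> \<equiv> 1 / (real n * (1 + R))"

lemma set_pmf_glauber:
  assumes S: "S \<in> X"
  shows "set_pmf (glauber n X \<mu> S) \<subseteq> X"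
  using n_pos X_down[OF S]
  by (auto simp: glauber_def Let_def set_pmf_of_set split: if_splits)

lemma finite_set_pmf_site: "finite (set_pmf
    (let S' = S - {i} in
     if insert i S' \<notin> X then return_pmf S'
     else map_pmf (\<lambda>b. if b then insert i S' else S')
            (bernoulli_pmf (pmf \<mu> (insert i S') / (pmf \<mu> S' + pmf \<mu> (insert i S'))))))"
  by (simp add: Let_def)

lemma expectation_glauber:
  assumes S: "S \<in> X"
  shows "measure_pmf.expectation (glauber n X \<mu> S) f
    = (\<Sum>i\<in>{1..n}. site_update X (pmf \<mu>) i f S) / real n"
proof -
  have site: "measure_pmf.expectation
    (let S' = S - {i} in
     if insert i S' \<notin> X then return_pmf S'
     else map_pmf (\<lambda>b. if b then insert i S' else S')
            (bernoulli_pmf (pmf \<mu> (insert i S') / (pmf \<mu> S' + pmf \<mu> (insert i S'))))) f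
    = site_update X (pmf \<mu>) i f S" for i
  proof (cases "insert i S \<in> X")
    case True
    define s t where "s = pmf \<mu> (S - {i})" and "t = pmf \<mu> (insert i S)"
    have "0 < s" "0 < t"
      using m_pos[OF True] m_pos[OF X_down[OF S, of "S - {i}"]] by (auto simp: s_def t_def)
    then have st: "0 \<le> t / (s + t)" "t / (s + t) \<le> 1" "1 - t / (s + t) = s / (s + t)"
      by (auto simp: field_simps)
    then have "measure_pmf.expectation (map_pmf (\<lambda>b. if b then insert i S else S - {i})
        (bernoulli_pmf (t / (s + t)))) f = (s * f (S - {i}) + t * f (insert i S)) / (s + t)"
      by (simp add: integral_map_pmf integral_bernoulli_pmf st(3) add_divide_distrib mult_ac)
    moreover have "insert i (S - {i}) = insert i S" by simp
    ultimately show ?thesis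
      using True unfolding Let_def by (simp only: site_update_def s_def t_def simp_thms if_False)
  qed (simp add: Let_def site_update_def)
  have "measure_pmf.expectation (glauber n X \<mu> S) f
      = (\<Sum>i\<in>{1..n}. site_update X (pmf \<mu>) i f S /\<^sub>R real (card {1..n}))"
    unfolding glauber_def using n_pos finite_set_pmf_site
    by (subst pmf_expectation_bind_pmf_of_set) (simp_all only: site, auto)
  then show ?thesis by (simp add: sum_distrib_left divide_inverse_commute)
qed

lemma expectation_on_X:
  assumes "set_pmf q \<subseteq> X"
  shows "measure_pmf.expectation q f = (\<Sum>T\<in>X. pmf q T * f T)"
  using assms finite_X by (subst integral_measure_pmf[of X]) auto

lemma pmf_total:
  assumes "set_pmf q \<subseteq> X"
  shows "(\<Sum>T\<in>X. pmf q T) = 1"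
  using sum_pmf_eq_1[OF finite_X assms] .

lemma set_pmf_\<mu>: "set_pmf \<mu> \<subseteq> X"
proof
  fix S assume "S \<in> set_pmf \<mu>"
  then have "pmf \<mu> S \<noteq> 0" by (simp add: set_pmf_iff)
  then show "S \<in> X" using m_zero[of S] by blast
qed

text \<open>The average of \<open>site_dirichlet\<close> over all sites. Two functions are allowed:
  equal ones serve the gap, \<open>f\<close> and \<open>ln f\<close> the log-Sobolev inequality,
  indicators reversibility.\<close>

lemma glauber_dirichlet:
  "(\<Sum>S\<in>X. pmf \<mu> S * f S * g S) - (\<Sum>S\<in>X. pmf \<mu> S * (\<Sum>T\<in>X. pmf (glauber n X \<mu> S) T * f T) * g S)
    = (\<Sum>S\<in>X. \<Sum>i\<in>ext S. edge_weight S i * ((f (insert i S) - f S) * (g (insert i S) - g S))) / real n"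
proof -
  have "(\<Sum>S\<in>X. pmf \<mu> S * (\<Sum>T\<in>X. pmf (glauber n X \<mu> S) T * f T) * g S)
      = (\<Sum>S\<in>X. \<Sum>i\<in>{1..n}. pmf \<mu> S * site_update X (pmf \<mu>) i f S * g S / real n)"
    by (intro sum.cong refl)
      (simp add: expectation_glauber set_pmf_glauber sum_distrib_left sum_distrib_right
        sum_divide_distrib flip: expectation_on_X)
  also have "\<dots> = (\<Sum>i\<in>{1..n}. (\<Sum>S\<in>X. pmf \<mu> S * site_update X (pmf \<mu>) i f S * g S) / real n)"
    unfolding sum_divide_distrib by (rule sum.swap)
  also have "(\<Sum>S\<in>X. pmf \<mu> S * f S * g S) - \<dots>
      = (\<Sum>i\<in>{1..n}. ((\<Sum>S\<in>X. pmf \<mu> S * f S * g S)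
          - (\<Sum>S\<in>X. pmf \<mu> S * site_update X (pmf \<mu>) i f S * g S)) / real n)"
    using n_pos by (simp add: diff_divide_distrib sum_subtractf)
  also have "\<dots> = (\<Sum>i\<in>{1..n}. \<Sum>S\<in>{S \<in> X. i \<in> ext S}.
      edge_weight S i * ((f (insert i S) - f S) * (g (insert i S) - g S))) / real n"
    unfolding sum_divide_distrib
    by (intro sum.cong refl) (simp only: site_dirichlet sum_divide_distrib)
  finally show ?thesis by (simp only: sum_sites)
qed

text \<open>Nonnegativity of each edge term allows comparison edge by edge; \<open>\<rho>\<close>
  combines the loss \<open>1 + R\<close> with the probability \<open>1 / n\<close> of choosing a
  site.\<close>

lemma dirichlet_ge:
  assumes d: "\<And>S i. S \<in> X \<Longrightarrow> i \<in> ext S \<Longrightarrow> 0 \<le> (f (insert i S) - f S) * (g (insert i S) - g S)"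
    and E: "E \<le> (\<Sum>S\<in>X. \<Sum>i\<in>ext S. pmf \<mu> (insert i S) * ((f (insert i S) - f S) * (g (insert i S) - g S)))"
  shows "\<rho> * E \<le> (\<Sum>S\<in>X. pmf \<mu> S * f S * g S)
    - (\<Sum>S\<in>X. pmf \<mu> S * (\<Sum>T\<in>X. pmf (glauber n X \<mu> S) T * f T) * g S)"
proof -
  define D where "D = (\<Sum>S\<in>X. \<Sum>i\<in>ext S.
      edge_weight S i * ((f (insert i S) - f S) * (g (insert i S) - g S)))"
  have "E \<le> (\<Sum>S\<in>X. \<Sum>i\<in>ext S.
      (1 + R) * (edge_weight S i * ((f (insert i S) - f S) * (g (insert i S) - g S))))"
    by (intro order.trans[OF E] sum_mono edge_weight_ge ratio_le R_nonneg d)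
  also have "\<dots> = (1 + R) * D"
    by (simp only: D_def sum_distrib_left)
  finally have "\<rho> * E \<le> \<rho> * ((1 + R) * D)"
    using R_nonneg by (intro mult_left_mono) auto
  also have "\<dots> = D / real n" using R_nonneg by simp
  finally show ?thesis unfolding glauber_dirichlet D_def .
qed

sublocale chain: reversible_chain X "pmf \<mu>" "\<lambda>S T. pmf (glauber n X \<mu> S) T"
proof
  show "finite X" by (rule finite_X)
  show "0 < pmf \<mu> S" if "S \<in> X" for S using m_pos[OF that] .
  show "(\<Sum>S\<in>X. pmf \<mu> S) = 1" by (rule pmf_total[OF set_pmf_\<mu>])
  show "0 \<le> pmf (glauber n X \<mu> S) T" for S T by simp
  show "(\<Sum>T\<in>X. pmf (glauber n X \<mu> S) T) = 1" if "S \<in> X" for S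
    by (rule pmf_total[OF set_pmf_glauber[OF that]])
next
  fix S T assume S: "S \<in> X" and T: "T \<in> X"
  \<comment> \<open>Detailed balance is read off the symmetry of the Dirichlet form on indicators of
    single states.\<close>
  let ?f = "\<lambda>U. if U = T then 1 else 0 :: real" and ?g = "\<lambda>U. if U = S then 1 else 0 :: real"
  have delta: "(\<Sum>V\<in>X. h V * (if V = U then 1 else 0)) = h U" if "U \<in> X" for h :: "nat set \<Rightarrow> real" and U
    using that finite_X by (simp add: mult_delta_right)
  have "(\<Sum>U\<in>X. pmf \<mu> U * (\<Sum>V\<in>X. pmf (glauber n X \<mu> U) V * ?f V) * ?g U)
      = pmf \<mu> S * pmf (glauber n X \<mu> S) T"
    by (simp only: delta S T)
  moreover have "(\<Sum>U\<in>X. pmf \<mu> U * (\<Sum>V\<in>X. pmf (glauber n X \<mu> U) V * ?g V) * ?f U)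
      = pmf \<mu> T * pmf (glauber n X \<mu> T) S"
    by (simp only: delta S T)
  moreover have "(\<Sum>U\<in>X. pmf \<mu> U * ?f U * ?g U) = (\<Sum>U\<in>X. pmf \<mu> U * ?g U * ?f U)"
    by (simp add: mult_ac)
  ultimately show "pmf \<mu> S * pmf (glauber n X \<mu> S) T = pmf \<mu> T * pmf (glauber n X \<mu> T) S"
    using glauber_dirichlet[of ?f ?g] glauber_dirichlet[of ?g ?f]
    by (simp only: mult.commute[of "?f _ - ?f _" "?g _ - ?g _"])
qed

sublocale chain: mlsi_chain X "pmf \<mu>" "\<lambda>S T. pmf (glauber n X \<mu> S) T" \<rho>
proof
  show "0 < \<rho>" using n_pos R_nonneg by simp
  have "1 * 1 \<le> real n * (1 + R)" using n_pos R_nonneg by (intro mult_mono) auto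
  then show "\<rho> \<le> 1" by simp
  show "0 \<le> chain.inner (chain.step f) f" for f
  proof -
    have "chain.inner (chain.step f) f = (\<Sum>S\<in>X. \<Sum>i\<in>{1..n}. pmf \<mu> S * site_update X (pmf \<mu>) i f S * f S / real n)"
      unfolding chain.inner_def chain.step_def
      by (intro sum.cong refl)
        (simp add: expectation_glauber set_pmf_glauber sum_distrib_left sum_distrib_right
          sum_divide_distrib flip: expectation_on_X)
    also have "\<dots> = (\<Sum>i\<in>{1..n}. (\<Sum>S\<in>X. pmf \<mu> S * site_update X (pmf \<mu>) i f S * f S) / real n)"
      unfolding sum_divide_distrib by (rule sum.swap)
    also have "\<dots> \<ge> 0"
      by (intro sum_nonneg divide_nonneg_nonneg site_psd) auto
    finally show ?thesis .
  qed
next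
  fix g assume g: "chain.inner g (\<lambda>_. 1) = 0"
  have "(\<Sum>S\<in>X. pmf \<mu> S * (g S)\<^sup>2) / 10
      \<le> (\<Sum>S\<in>X. \<Sum>i\<in>ext S. pmf \<mu> (insert i S) * (g (insert i S) - g S)\<^sup>2)"
    using g by (intro poincare_flux chain.weight_total) (simp add: chain.inner_def)
  then have "\<rho> * ((\<Sum>S\<in>X. pmf \<mu> S * (g S)\<^sup>2) / 10) \<le> chain.inner g g - chain.inner (chain.step g) g"
    unfolding chain.inner_def chain.step_def by (intro dirichlet_ge) (auto simp: power2_eq_square)
  moreover have "chain.inner g g = (\<Sum>S\<in>X. pmf \<mu> S * (g S)\<^sup>2)"
    by (simp add: chain.inner_def power2_eq_square mult.assoc)
  ultimately show "\<rho> / 10 * chain.inner g g \<le> chain.inner g g - chain.inner (chain.step g) g"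
    by simp
next
  fix h assume h: "\<And>S. S \<in> X \<Longrightarrow> 0 < h S" and tot: "chain.inner h (\<lambda>_. 1) = 1"
  show "\<rho> * chain.ent h \<le> chain.inner h (\<lambda>S. ln (h S)) - chain.inner (chain.step h) (\<lambda>S. ln (h S))"
    unfolding chain.inner_def chain.step_def
  proof (rule dirichlet_ge)
    fix S i assume S: "S \<in> X" and i: "i \<in> ext S"
    have "0 < h S" "0 < h (insert i S)" using h S extD(3)[OF i] by auto
    then show "0 \<le> (h (insert i S) - h S) * (ln (h (insert i S)) - ln (h S))"
      by (cases "h S \<le> h (insert i S)")
        (auto intro: mult_nonneg_nonneg mult_nonpos_nonpos)
  next
    show "chain.ent h \<le> (\<Sum>S\<in>X. \<Sum>i\<in>ext S.
        pmf \<mu> (insert i S) * ((h (insert i S) - h S) * (ln (h (insert i S)) - ln (h S))))"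
      unfolding chain.ent_def using tot
      by (intro mlsi_flux h chain.weight_total) (simp_all add: chain.inner_def)
  qed
qed

section \<open>From test functions to total variation and the mixing time\<close>

lemma chain_dist_Suc: "chain_dist P (Suc t) S = chain_dist P t S \<bind> P"
  by (simp add: chain_dist_def)

lemma set_pmf_chain_dist:
  assumes S: "S \<in> X"
  shows "set_pmf (chain_dist (glauber n X \<mu>) t S) \<subseteq> X"
proof (induction t)
  case 0
  show ?case using S by (simp add: chain_dist_def)
next
  case (Suc t)
  then show ?case
    unfolding chain_dist_Suc set_bind_pmf using set_pmf_glauber by blast
qed

text \<open>The induction keeps \<open>f\<close> arbitrary because the last transition is absorbed
  into the test function.\<close>

lemma expectation_chain_dist:
  assumes S: "S \<in> X"
  shows "measure_pmf.expectation (chain_dist (glauber n X \<mu>) t S) f = (chain.step ^^ t) f S"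
proof (induction t arbitrary: f)
  case 0
  show ?case by (simp add: chain_dist_def)
next
  case (Suc t)
  let ?q = "chain_dist (glauber n X \<mu>) t S"
  note q = set_pmf_chain_dist[OF S, of t]
  have "measure_pmf.expectation (?q \<bind> glauber n X \<mu>) f
      = (\<Sum>T\<in>X. pmf ?q T *\<^sub>R measure_pmf.expectation (glauber n X \<mu> T) f)"
    using q set_pmf_glauber finite_X finite_subset[OF set_pmf_glauber finite_X]
    by (intro pmf_expectation_bind) auto
  also have "\<dots> = (\<Sum>T\<in>X. pmf ?q T * chain.step f T)"
    by (intro sum.cong refl) (simp add: chain.step_def expectation_on_X set_pmf_glauber)
  also have "\<dots> = measure_pmf.expectation ?q (chain.step f)"
    by (rule expectation_on_X[OF q, symmetric])
  also have "\<dots> = (chain.step ^^ t) (chain.step f) S" by (rule Suc.IH)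
  finally show ?case
    by (simp only: chain_dist_Suc chain.iterate_step)
qed

lemma d_TV_chain_dist:
  assumes S: "S \<in> X" and m0: "0 < m0" "\<And>T. T \<in> X \<Longrightarrow> m0 \<le> pmf \<mu> T"
    and k: "ln (1 / m0) \<le> 2 ^ k / 4096"
    and a: "20000 / \<rho> \<le> real a" and L: "2 * real k / \<rho> \<le> real L" "0 < L"
  shows "d_TV (chain_dist (glauber n X \<mu>) (a + L) S) \<mu> \<le> 1 / 4"
  unfolding d_TV_def
proof (rule cSUP_least)
  fix A :: "nat set set"
  let ?q = "chain_dist (glauber n X \<mu>) (a + L) S"
  define c where "c = measure_pmf.prob \<mu> A"
  \<comment> \<open>The centred indicator of \<open>A\<close>, written in the form that
    \<open>iterate_lin\<close> expects.\<close>
  define f where "f T = 1 * indicator A T - c * 1" for T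
  have c: "0 \<le> c" "c \<le> 1" by (simp_all add: c_def)
  have c_sum: "c = (\<Sum>T\<in>X. pmf \<mu> T * indicator A T)"
    using expectation_on_X[OF set_pmf_\<mu>, of "indicator A"] by (simp add: c_def)
  have "chain.inner f (\<lambda>_. 1) = (\<Sum>T\<in>X. pmf \<mu> T * indicator A T) - (\<Sum>T\<in>X. pmf \<mu> T) * c"
    by (simp add: chain.inner_def f_def right_diff_distrib sum_subtractf sum_distrib_right)
  then have mean: "chain.inner f (\<lambda>_. 1) = 0"
    using chain.weight_total by (simp flip: c_sum)
  have "\<bar>f T\<bar> \<le> 1" for T using c by (auto simp: f_def indicator_def)
  then have "\<bar>(chain.step ^^ (a + L)) f S\<bar> \<le> 1 / 4"
    using chain.mixing[OF S m0 mean _ k a L] by blast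
  moreover have "(chain.step ^^ (a + L)) f S = (chain.step ^^ (a + L)) (indicator A) S - c"
    unfolding f_def chain.iterate_lin[of "a + L" 1 "indicator A" c "\<lambda>_. 1"]
    by (simp add: chain.iterate_const[OF S])
  moreover have "(chain.step ^^ (a + L)) (indicator A) S = measure_pmf.prob ?q A"
    using expectation_chain_dist[OF S, of "a + L" "indicator A"] by simp
  ultimately show "\<bar>measure_pmf.prob ?q A - measure_pmf.prob \<mu> A\<bar> \<le> 1 / 4"
    by (simp add: c_def)
qed simp

lemma T_mix_le:
  "ereal_of_enat (T_mix X (glauber n X \<mu>) \<mu>)
     \<le> ereal (30000 * ((1 + R) * real n * loglog (1 / \<mu>_min X \<mu>)))"
proof -
  define m0 where "m0 = \<mu>_min X \<mu>"
  define \<Lambda> where "\<Lambda> = loglog (1 / m0)"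
  have \<Lambda>: "1 \<le> \<Lambda>" by (simp add: \<Lambda>_def loglog_def)
  have m0: "0 < m0" "\<And>T. T \<in> X \<Longrightarrow> m0 \<le> pmf \<mu> T"
    using finite_X X_nonempty m_pos by (simp_all add: m0_def \<mu>_min_def)
  \<comment> \<open>The maximum keeps \<open>log 2 l\<close> nonnegative for \<open>m0\<close> close
    to \<open>1\<close>; the \<open>12\<close> further halvings in \<open>k\<close> supply
    \<open>4096 = 2 ^ 12\<close>.\<close>
  define l where "l = max 1 (ln (1 / m0))"
  define k where "k = nat \<lceil>log 2 l\<rceil> + 12"
  have l: "1 \<le> l" by (simp add: l_def)
  have "l = 2 powr (log 2 l)" using l by simp
  also have "\<dots> \<le> 2 powr real (nat \<lceil>log 2 l\<rceil>)"
    by (intro powr_mono) linarith+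
  also have "\<dots> = 2 ^ k / 4096" by (simp add: k_def powr_realpow power_add)
  finally have k: "ln (1 / m0) \<le> 2 ^ k / 4096" by (simp add: l_def)
  \<comment> \<open>If \<open>ln (1 / m0) < 1\<close>, then \<open>l = 1\<close> and the left side
    is \<open>0\<close>.\<close>
  have "ln l \<le> \<Lambda>"
    using \<Lambda> by (cases "1 \<le> ln (1 / m0)") (auto simp: l_def \<Lambda>_def loglog_def max_def)
  have k_le: "real k \<le> 13 + 2 * \<Lambda>"
  proof -
    have "0 \<le> log 2 l" using l by simp
    then have "real k \<le> log 2 l + 13" unfolding k_def by linarith
    also have "log 2 l \<le> 2 * ln l"
    proof -
      have "1 / 2 \<le> ln (2 :: real)" using ln2_ge_two_thirds by simp
      then have "ln l * 1 \<le> ln l * (2 * ln 2)" using l by (intro mult_left_mono) auto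
      then show ?thesis by (simp add: log_def divide_le_eq mult_ac)
    qed
    finally show ?thesis using \<open>ln l \<le> \<Lambda>\<close> by linarith
  qed
  define \<theta> where "\<theta> = real n * (1 + R)"
  have \<theta>: "1 \<le> \<theta>"
    using mult_mono[of 1 "real n" 1 "1 + R"] n_pos R_nonneg by (simp add: \<theta>_def)
  define a where "a = nat \<lceil>20000 * \<theta>\<rceil>"
  define L where "L = nat \<lceil>2 * real k * \<theta>\<rceil> + 1"
  have aL: "20000 * \<theta> \<le> real a" "2 * real k * \<theta> \<le> real L" "0 < L"
    unfolding a_def L_def by linarith+
  have tv: "d_TV (chain_dist (glauber n X \<mu>) (a + L) S) \<mu> \<le> 1 / 4" if "S \<in> X" for S
    using aL by (intro d_TV_chain_dist[OF that m0 k]) (simp_all add: \<theta>_def)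
  have "T_mix X (glauber n X \<mu>) \<mu> \<le> enat (a + L)"
    unfolding T_mix_def by (intro SUP_least INF_lower CollectI tv)
  then have "ereal_of_enat (T_mix X (glauber n X \<mu>) \<mu>) \<le> ereal_of_enat (enat (a + L))"
    by (simp only: ereal_of_enat_le_iff)
  also have "\<dots> = ereal (real (a + L))" by simp
  also have "\<dots> \<le> ereal (30000 * (\<theta> * \<Lambda>))"
  proof -
    have "real a \<le> 20000 * \<theta> + 1" using \<theta> unfolding a_def by linarith
    moreover have "0 \<le> 2 * real k * \<theta>" using \<theta> by simp
    then have "real L \<le> 2 * real k * \<theta> + 2" unfolding L_def by linarith
    \<comment> \<open>\<open>2 * k \<le> 26 + 4 * \<Lambda> \<le> 30 * \<Lambda>\<close>, as
      \<open>\<Lambda> \<ge> 1\<close>.\<close>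
    moreover have "2 * real k * \<theta> \<le> 30 * (\<theta> * \<Lambda>)"
    proof -
      have "(2 * real k) * \<theta> \<le> (30 * \<Lambda>) * \<theta>"
        using k_le \<Lambda> \<theta> by (intro mult_right_mono) auto
      then show ?thesis by (simp add: mult_ac)
    qed
    moreover have "\<theta> * 1 \<le> \<theta> * \<Lambda>" using \<theta> \<Lambda> by (intro mult_left_mono) auto
    ultimately have "real (a + L) \<le> 30000 * (\<theta> * \<Lambda>)" using \<theta> by linarith
    then show ?thesis by simp
  qed
  finally show ?thesis by (simp add: \<theta>_def \<Lambda>_def m0_def mult_ac)
qed

end

text \<open>Evaluate the form of \<open>I - M\<close> at
  \<open>y i = pmf \<mu> (insert i S) * x i\<close>: this clears the denominators, the normaliser of
  the link cancels, and the entries \<open>1\<close> add up to the square of the sum of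
  \<open>y\<close>. For maximal \<open>S\<close> both sides vanish.\<close>

lemma log_concave_at_of_loewner:
  assumes sub: "X \<subseteq> Pow {1..n}" and down: "downward_closed X" and supp: "fully_supported \<mu> X"
    and S: "S \<in> X"
    and dep: "\<not> is_maximal n X S \<Longrightarrow>
      loewner_le (extensions n X S) (dependency_matrix n X \<mu> S) identity_matrix"
  shows "log_concave_at {1..n} (pmf \<mu>) S"
  unfolding log_concave_at_def
proof
  fix x :: "nat \<Rightarrow> real"
  define V where "V = extensions n X S"
  define Z where "Z = (\<Sum>U\<in>link n X S. pmf \<mu> (S \<union> U))"
  have pos: "0 < pmf \<mu> T" if "T \<in> X" for T using supp that by (simp add: fully_supported_def)
  have zero: "pmf \<mu> T = 0" if "T \<notin> X" for T using supp that by (simp add: fully_supported_def)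
  have down': "T \<in> X" if "U \<in> X" "T \<subseteq> U" for T U
    using down that by (auto simp: downward_closed_def)
  have V: "V \<subseteq> {1..n} - S" "finite ({1..n} - S)" by (auto simp: V_def extensions_def)
  have fin_link: "finite (link n X S)"
    by (rule finite_subset[of _ "Pow {1..n}"]) (auto simp: link_def)
  have empty_link: "{} \<in> link n X S" using S by (simp add: link_def)
  have Z: "0 < Z"
    unfolding Z_def using fin_link empty_link by (intro sum_pos) (auto simp: link_def intro: pos)
  have lp: "link_prob n X \<mu> S T = pmf \<mu> (S \<union> T) / Z" if "T \<subseteq> {1..n} - S" for T
    using that zero by (auto simp: link_prob_def link_def Z_def)
  have i_pos: "0 < pmf \<mu> (insert i S)" if "i \<in> V" for i
    using that by (intro pos) (simp add: V_def extensions_def)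
  have lin: "(\<Sum>i\<in>{1..n} - S. pmf \<mu> (insert i S) * x i) = (\<Sum>i\<in>V. pmf \<mu> (insert i S) * x i)"
    using V zero by (intro sum.mono_neutral_right) (auto simp: V_def extensions_def)
  have pair_zero: "pmf \<mu> (insert i (insert j S)) = 0"
    if "i \<in> {1..n} - S - V \<or> j \<in> {1..n} - S - V" for i j
  proof (rule zero)
    show "insert i (insert j S) \<notin> X"
      using that down'[of "insert i (insert j S)" "insert i S"]
        down'[of "insert i (insert j S)" "insert j S"] by (auto simp: V_def extensions_def)
  qed
  let ?P = "\<lambda>i j. if i = j then 0 else pmf \<mu> (insert i (insert j S)) * x i * x j"
  have quad: "(\<Sum>i\<in>{1..n} - S. \<Sum>j\<in>{1..n} - S. ?P i j) = (\<Sum>i\<in>V. \<Sum>j\<in>V. ?P i j)"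
  proof -
    have "(\<Sum>i\<in>V. \<Sum>j\<in>V. ?P i j) = (\<Sum>i\<in>V. \<Sum>j\<in>{1..n} - S. ?P i j)"
      using V pair_zero by (intro sum.cong refl sum.mono_neutral_left) auto
    also have "\<dots> = (\<Sum>i\<in>{1..n} - S. \<Sum>j\<in>{1..n} - S. ?P i j)"
      using V pair_zero by (intro sum.mono_neutral_left ballI sum.neutral) auto
    finally show ?thesis ..
  qed
  show "pmf \<mu> S * (\<Sum>i\<in>{1..n} - S. \<Sum>j\<in>{1..n} - S. ?P i j)
      \<le> (\<Sum>i\<in>{1..n} - S. pmf \<mu> (insert i S) * x i)\<^sup>2"
    unfolding lin quad
  proof (cases "V = {}")
    case False
    then have "\<not> is_maximal n X S" by (simp add: is_maximal_def V_def)
    then have psd: "psd_on V (\<lambda>i j. identity_matrix i j - dependency_matrix n X \<mu> S i j)"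
      using dep by (simp add: loewner_le_def V_def)
    define y where "y i = pmf \<mu> (insert i S) * x i" for i
    have "0 \<le> (\<Sum>i\<in>V. \<Sum>j\<in>V. y i * (identity_matrix i j - dependency_matrix n X \<mu> S i j) * y j)"
      using psd by (simp add: psd_on_def)
    also have "\<dots> = (\<Sum>i\<in>V. \<Sum>j\<in>V. y i * y j - pmf \<mu> S * ?P i j)"
    proof (intro sum.cong refl)
      fix i j assume i: "i \<in> V" and j: "j \<in> V"
      show "y i * (identity_matrix i j - dependency_matrix n X \<mu> S i j) * y j
          = y i * y j - pmf \<mu> S * ?P i j"
      proof (cases "i = j")
        case False
        have sub: "{i, j} \<subseteq> {1..n} - S" "{i} \<subseteq> {1..n} - S" "{j} \<subseteq> {1..n} - S" using i j V by auto
        have "dependency_matrix n X \<mu> S i j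
            = (pmf \<mu> (insert i (insert j S)) * pmf \<mu> S) / (pmf \<mu> (insert i S) * pmf \<mu> (insert j S)) - 1"
          using False Z lp[OF sub(1)] lp[OF sub(2)] lp[OF sub(3)] lp[of "{}"]
          by (simp add: dependency_matrix_def)
        note dm = this
        show ?thesis
          unfolding dm using False i_pos[OF i] i_pos[OF j] by (simp add: identity_matrix_def y_def field_simps)
      qed (simp add: identity_matrix_def dependency_matrix_def)
    qed
    also have "\<dots> = (\<Sum>i\<in>V. \<Sum>j\<in>V. y i * y j) - pmf \<mu> S * (\<Sum>i\<in>V. \<Sum>j\<in>V. ?P i j)"
      by (simp only: sum_subtractf sum_distrib_left)
    also have "(\<Sum>i\<in>V. \<Sum>j\<in>V. y i * y j) = (\<Sum>i\<in>V. y i)\<^sup>2"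
      by (simp only: power2_eq_square sum_product)
    finally show "pmf \<mu> S * (\<Sum>i\<in>V. \<Sum>j\<in>V. ?P i j) \<le> (\<Sum>i\<in>V. pmf \<mu> (insert i S) * x i)\<^sup>2"
      by (simp add: y_def)
  qed simp
qed

text \<open>For \<open>n = 0\<close> the claimed bound is \<open>0\<close>, so the chain must be at
  equilibrium at time \<open>0\<close>; this holds for any kernel \<open>P\<close>.\<close>

lemma T_mix_ground_empty:
  assumes X: "X = {{}}" and supp: "fully_supported \<mu> X"
  shows "T_mix X P \<mu> = 0"
proof -
  have "set_pmf \<mu> = {{}}"
    using supp unfolding X fully_supported_def set_pmf_eq by (auto split: if_splits)
  then have "\<mu> = return_pmf {}" by (simp flip: set_pmf_subset_singleton)
  then have "d_TV (chain_dist P 0 {}) \<mu> \<le> 1 / 4"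
    by (simp add: chain_dist_def d_TV_def)
  then have "T_mix X P \<mu> \<le> enat 0"
    unfolding T_mix_def X by (intro SUP_least INF_lower CollectI) auto
  then show ?thesis by (simp flip: zero_enat_def)
qed

theorem theorem1p8:
  shows "\<exists>C::real. C > 0 \<and>
    (\<forall>(n::nat) (X::nat set set) (\<mu>::nat set pmf).
       X \<subseteq> Pow {1..n} \<longrightarrow> X \<noteq> {} \<longrightarrow> downward_closed X \<longrightarrow> fully_supported \<mu> X \<longrightarrow>
       (\<forall>S\<in>X. \<not> is_maximal n X S \<longrightarrow>
          loewner_le (extensions n X S) (dependency_matrix n X \<mu> S) identity_matrix) \<longrightarrow>
       ereal_of_enat (T_mix X (glauber n X \<mu>) \<mu>)
         \<le> ereal (C * ((1 + r_max n X \<mu>) * real n * loglog (1 / \<mu>_min X \<mu>))))"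
proof (intro exI conjI allI impI)
  show "(0 :: real) < 30000" by simp
  fix n :: nat and X :: "nat set set" and \<mu> :: "nat set pmf"
  assume sub: "X \<subseteq> Pow {1..n}" and ne: "X \<noteq> {}" and down: "downward_closed X"
    and supp: "fully_supported \<mu> X"
    and dep: "\<forall>S\<in>X. \<not> is_maximal n X S \<longrightarrow>
      loewner_le (extensions n X S) (dependency_matrix n X \<mu> S) identity_matrix"
  show "ereal_of_enat (T_mix X (glauber n X \<mu>) \<mu>)
      \<le> ereal (30000 * ((1 + r_max n X \<mu>) * real n * loglog (1 / \<mu>_min X \<mu>)))"
  proof (cases "n = 0")
    case True
    then have "X = {{}}" using sub ne by auto
    then show ?thesis using T_mix_ground_empty[OF _ supp] True by simp
  next
    case False
    have finX: "finite X" using sub by (rule finite_subset) simp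
    interpret log_concave_complex "{1..n}" X "pmf \<mu>"
    proof
      show "finite {1..n}" by simp
      show "S \<in> X" if "T \<in> X" "S \<subseteq> T" for S T
        using down that by (auto simp: downward_closed_def)
      show "log_concave_at {1..n} (pmf \<mu>) S" if "S \<in> X" for S
        using log_concave_at_of_loewner[OF sub down supp that] dep that by blast
    qed (use sub ne supp in \<open>auto simp: fully_supported_def split: if_splits\<close>)
    have ext: "ext S = extensions n X S" for S
      by (simp add: ext_def extensions_def del: One_nat_def)
    let ?A = "insert 0 (\<Union>S\<in>X. marginal_ratio \<mu> S ` extensions n X S)"
    have fin: "finite ?A"
      using finX finite_ext by (auto simp: ext[symmetric])
    interpret glauber_chain n X \<mu> "r_max n X \<mu>"
    proof
      show "0 < n" using False by simp
      \<comment> \<open>The inserted \<open>0\<close> covers the case in which no set has an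
        extension.\<close>
      show "0 \<le> r_max n X \<mu>" unfolding r_max_def using fin by (intro Max_ge) auto
      fix S i assume S: "S \<in> X" and i: "i \<in> ext S"
      have "marginal_ratio \<mu> S i \<le> r_max n X \<mu>"
        unfolding r_max_def using fin S i by (intro Max_ge) (auto simp: ext simp del: One_nat_def)
      then show "pmf \<mu> (insert i S) \<le> r_max n X \<mu> * pmf \<mu> S"
        using m_pos[OF S] by (simp add: marginal_ratio_def divide_le_eq)
    qed
    show ?thesis by (rule T_mix_le)
  qed
qed

end
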